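(* Let $A:X\to Y$ be an injective bounded linear operator with non-closed range between Hilbert spaces. Let $\Psi$ be an index function that is concave and strictly increasing on $(0,\infty)$ with $\lim_{\lambda\to+0}\Psi(\lambda)=0$, $\lim_{\lambda\to\infty}\Psi(\lambda)=\infty$ and $\lim_{\lambda\to\infty}\Psi(\lambda)/\lambda=0$, and set $$\chi(\lambda):=\frac{\Psi^{-1}(\lambda)}{\lambda},\ 0<\lambda<\infty,\qquad \bar\psi(t):=\frac{1}{\sqrt{\chi(1/t)}},\quad \Theta(t):=\sqrt t\,\bar\psi(t),\ 0<t<\infty .$$ Let $Af=g$ with $f\in X_\chi=\operatorname{range}(\bar\psi(A^*A))$, and for data $g^\delta\in Y$ with $\|g-g^\delta\|\le\delta$ consider regularised solutions $$f_\alpha=h_\alpha(A^*A)A^*g^\delta ,$$ where $\{h_\alpha\}_{0<\alpha\le\alpha_{max}}$ is a family of piecewise continuous real functions on $(0,\|A\|^2]$ such that, with $r_\alpha(t):=t\,h_\alpha(t)-1$, $$\lim_{\alpha\to+0}r_\alpha(t)=0\quad(0<t\le\|A\|^2),\qquad \sup_{0<\alpha\le\alpha_{max}}\ \sup_{0<t\le\|A\|^2}t\,|h_\alpha(t)|\le C_1$$ for a constant $C_1>0$. Suppose there is a function $\Gamma$ with $$\sup_{0<t\le\|A\|^2}\frac{\sqrt t\,|h_\alpha(t)|}{\bar\psi(t)}\le\Gamma(\alpha)\quad\text{for all sufficiently small }\alpha>0,$$ such that, for some constant $C_{para}>0$, $$\delta\,\Gamma(\Theta^{-1}(\delta))\le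 C_{para},\qquad 0<\delta\le\delta_{max},$$ and suppose that $\Theta$ is a qualification of the method, i.e. there is a constant $C_{quali}>0$ with $$\sup_{0<t\le\|A\|^2}|r_\alpha(t)|\,\Theta(t)\le C_{quali}\,\Theta(\alpha),\qquad 0<\alpha\le\alpha_{max}.$$ Then for the a priori regularisation parameter choice $\alpha=\alpha(\delta):=\Theta^{-1}(\delta)\to+0$ as $\delta\to+0$ we have the convergence rate $$\|f-f_\alpha\|=\mathcal O\left(\delta\sqrt{\Psi(\bar K/\delta^2)}\right)\qquad\text{as }\delta\to+0$$ with some constant $\bar K>0$.
   Context: $X$ and $Y$ are infinite dimensional separable Hilbert spaces, with norms denoted $\|\cdot\|$. An index function is a continuous function $(0,\infty)\to(0,\infty)$; $\Psi^{-1}$, $\Theta^{-1}$ are inverse functions. $X_\chi$ is the space with index $\chi$ of the variable Hilbert scale generated by $T=(A^*A)^{-1}$: the closure (completion) of the domain of the quadratic form $\|h\|_\chi^2=(h,\chi(T)h)$, with norm $\|\cdot\|_\chi$. If $A:X\to Y$ is injective, bounded and linear with non-closed range, $\Psi$ is a concave and strictly increasing index function with $\lim_{\lambda\to+0}\Psi(\lambda)=0$, $\lim_{\lambda\to\infty}\Psi(\lambda)=\infty$ and $\lim_{\lambda\to\infty}\Psi(\lambda)/\lambda=0$, and $\chi(\lambda)=\Psi^{-1}(\lambda)/\lambda$, $\bar\psi(t)=1/\sqrt{\chi(1/t)}$, then $X_\chi=\operatorname{range}(\bar\psi(A^*A))$. Functions of $T$ and $A^*A$ are defined by the spectral calculus.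 $\alpha_{max}$ is a positive real number or $\infty$ (in the latter case $\alpha$ ranges over $(0,\infty)$), and $\delta_{max}>0$. *)

theory Defs
  imports "HOL-Analysis.Analysis" "HOL-Library.Landau_Symbols"
begin

section \<open>Spectral calculus of bounded self-adjoint operators\<close>

text \<open>
  The Hilbert spaces are real. This covers complex ones, regarded as real spaces with the inner
  product \<open>Re \<langle>x, y\<rangle>\<close>: norms, adjoints of complex-linear operators, their spectral measures and
  the calculus for real-valued functions do not change.
\<close>

text \<open>
  A spectral measure on the Borel sets of the real line. Taking \<open>S = T\<close> in the fourth clause,
  each \<open>E S\<close> is an orthogonal projection. Values of \<open>E\<close> off the Borel sets are irrelevant.
\<close>

definition projection_valued_measure :: "(real set \<Rightarrow> 'a::real_inner \<Rightarrow> 'a) \<Rightarrow> bool" where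
  "projection_valued_measure E \<longleftrightarrow>
     (\<forall>S\<in>sets borel. bounded_linear (E S)) \<and>
     (\<forall>S\<in>sets borel. \<forall>x y. E S x \<bullet> y = x \<bullet> E S y) \<and>
     (\<forall>x. E UNIV x = x) \<and>
     (\<forall>S\<in>sets borel. \<forall>T\<in>sets borel. \<forall>x. E (S \<inter> T) x = E S (E T x)) \<and>
     (\<forall>F :: nat \<Rightarrow> real set. range F \<subseteq> sets borel \<longrightarrow> disjoint_family F \<longrightarrow>
        (\<forall>x. (\<lambda>n. E (F n) x) sums E (\<Union>n. F n) x))"

definition scalar_spectral_measure ::
    "(real set \<Rightarrow> 'a::real_inner \<Rightarrow> 'a) \<Rightarrow> 'a \<Rightarrow> real measure" where
  "scalar_spectral_measure E x = measure_of UNIV (sets borel) (\<lambda>S. ennreal (x \<bullet> E S x))"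

text \<open>
  The operator \<open>\<integral>\<^sub>S \<phi> dE\<close>, possibly unbounded, for a real function \<open>\<phi>\<close> of which only the values
  on \<open>S\<close> matter, given by its domain and its graph. The right-hand side in the graph is
  \<open>\<integral>\<^sub>S \<phi> d\<langle>E x, z\<rangle>\<close>, written with the positive measures \<open>\<langle>E u, u\<rangle>\<close> by polarization. The vector
  \<open>y\<close> is determined by \<open>x\<close> because the domain is dense.
\<close>

definition spectral_integral_domain ::
    "(real set \<Rightarrow> 'a::real_inner \<Rightarrow> 'a) \<Rightarrow> real set \<Rightarrow> (real \<Rightarrow> real) \<Rightarrow> 'a set" where
  "spectral_integral_domain E S \<phi> =
     {x. set_borel_measurable borel S \<phi> \<and>
         set_integrable (scalar_spectral_measure E x) S (\<lambda>t. (\<phi> t)\<^sup>2)}"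

definition spectral_integral ::
    "(real set \<Rightarrow> 'a::real_inner \<Rightarrow> 'a) \<Rightarrow> real set \<Rightarrow> (real \<Rightarrow> real) \<Rightarrow> ('a \<times> 'a) set" where
  "spectral_integral E S \<phi> =
     {(x, y). x \<in> spectral_integral_domain E S \<phi> \<and>
        (\<forall>z \<in> spectral_integral_domain E S \<phi>.
           y \<bullet> z = ((LINT t:S|scalar_spectral_measure E (x + z). \<phi> t) -
                     (LINT t:S|scalar_spectral_measure E (x - z). \<phi> t)) / 4)}"

definition spectral_resolution ::
    "('a::real_inner \<Rightarrow> 'a) \<Rightarrow> (real set \<Rightarrow> 'a \<Rightarrow> 'a) \<Rightarrow> bool" where
  "spectral_resolution B E \<longleftrightarrow>
     projection_valued_measure E \<and> (\<forall>x. (x, B x) \<in> spectral_integral E UNIV (\<lambda>t. t))"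

text \<open>
  The graph of \<open>\<phi>(B)\<close> for a function \<open>\<phi>\<close> on \<open>S\<close>, where \<open>S\<close> carries the spectral measure of \<open>B\<close>
  (otherwise \<open>\<phi>\<close> is extended by zero). By the spectral theorem a bounded self-adjoint \<open>B\<close> has a
  spectral resolution, unique on the Borel sets, so that the existential quantifier only names it.
\<close>

definition operator_function ::
    "real set \<Rightarrow> (real \<Rightarrow> real) \<Rightarrow> ('a::real_inner \<Rightarrow> 'a) \<Rightarrow> ('a \<times> 'a) set" where
  "operator_function S \<phi> B =
     {(x, y). \<exists>E. spectral_resolution B E \<and> (x, y) \<in> spectral_integral E S \<phi>}"

definition apply_operator_function ::
    "real set \<Rightarrow> (real \<Rightarrow> real) \<Rightarrow> ('a::real_inner \<Rightarrow> 'a) \<Rightarrow> 'a \<Rightarrow> 'a" where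
  "apply_operator_function S \<phi> B x = (THE y. (x, y) \<in> operator_function S \<phi> B)"


section \<open>Index functions\<close>

definition index_function :: "(real \<Rightarrow> real) \<Rightarrow> bool" where
  "index_function \<Psi> \<longleftrightarrow> continuous_on {0<..} \<Psi> \<and> (\<forall>x>0. \<Psi> x > 0)"

definition chi :: "(real \<Rightarrow> real) \<Rightarrow> real \<Rightarrow> real" where
  "chi \<Psi> x = inv_into {0<..} \<Psi> x / x"

definition psi_bar :: "(real \<Rightarrow> real) \<Rightarrow> real \<Rightarrow> real" where
  "psi_bar \<Psi> t = 1 / sqrt (chi \<Psi> (1 / t))"

definition Theta :: "(real \<Rightarrow> real) \<Rightarrow> real \<Rightarrow> real" where
  "Theta \<Psi> t = sqrt t * psi_bar \<Psi> t"

definition Theta_inv :: "(real \<Rightarrow> real) \<Rightarrow> real \<Rightarrow> real" where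
  "Theta_inv \<Psi> = inv_into {0<..} (Theta \<Psi>)"


section \<open>Regularisation\<close>

text \<open>
  Breakpoints may accumulate at endpoints that do not belong to \<open>S\<close>, and one-sided limits at
  the breakpoints are not required; every stricter notion of piecewise continuity implies this one.
\<close>

definition piecewise_continuous_on :: "real set \<Rightarrow> (real \<Rightarrow> real) \<Rightarrow> bool" where
  "piecewise_continuous_on S \<phi> \<longleftrightarrow>
     (\<forall>a b. {a..b} \<subseteq> S \<longrightarrow> (\<exists>T. finite T \<and> continuous_on ({a..b} - T) \<phi>))"

definition spectral_interval :: "('a::real_normed_vector \<Rightarrow> 'b::real_normed_vector) \<Rightarrow> real set" where
  "spectral_interval A = {0<..(onorm A)\<^sup>2}"

definition regularised_solution ::
    "('a::real_inner \<Rightarrow> 'b::real_inner) \<Rightarrow> (real \<Rightarrow> real \<Rightarrow> real) \<Rightarrow> 'b \<Rightarrow> real \<Rightarrow> 'a" where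
  "regularised_solution A h y \<alpha> =
     apply_operator_function (spectral_interval A) (h \<alpha>) (adjoint A \<circ> A) (adjoint A y)"

definition infinite_dimensional :: "'a::real_vector set \<Rightarrow> bool" where
  "infinite_dimensional V \<longleftrightarrow> \<not> (\<exists>B. finite B \<and> V \<subseteq> span B)"

end

(* Writing alpha = Theta^{-1}(delta), the definitions give Theta(t) = 1 / sqrt (Psi^{-1}(1/t)), hence
   alpha = 1 / Psi(1/delta^2) and psi_bar(alpha) = delta / sqrt alpha = delta * sqrt (Psi(1/delta^2)),
   so that K = 1 works. As psi_bar is nondecreasing (Psi(x)/x is nonincreasing by concavity),
   comparing t with alpha turns the hypotheses on Gamma and on the qualification into
   sqrt t |h_alpha(t)| <= c / sqrt alpha and |r_alpha(t)| psi_bar(t) <= c psi_bar(alpha), which bound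
   the propagated noise and the bias separately; no interpolation inequality is needed.

   The operators psi_bar(A^*A) and h_alpha(A^*A) may be unbounded. All computations are made after
   applying a spectral projection E T on whose range they are bounded, followed by a limit in T. *)

theory Submission
  imports Defs
begin

text \<open>The hypothesis on \<open>f\<close> supplies some spectral resolution \<open>E\<close>,
  whereas a regularised solution is a definite description over all resolutions of
  \<open>adjoint A \<circ> A\<close>. Relating the two requires that all resolutions give the same
  spectral integrals. This follows from the moments \<open>(B ^^ i) x \<bullet> x\<close>, once the
  measures are known to live on a bounded interval, where polynomials approximate continuous
  functions, and to have no mass at 0, where injectivity enters. The definitions see
  \<open>E\<close> only through positive measures of single vectors and polarization. Linearity and
  multiplicativity of the calculus must therefore be recovered from relations between integrals
  against different measures. Two regimes of \<open>t\<close> are forced: the bound on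
  \<open>t * \<bar>h \<alpha> t\<bar>\<close> does not control
  \<open>sqrt t * \<bar>h \<alpha> t\<bar>\<close> near 0, and the bound through
  \<open>\<Gamma> \<alpha> * psi_bar \<Psi> t\<close> exceeds the wanted order when \<open>t\<close>
  is large compared with \<open>\<alpha>\<close>. The choice of \<open>\<alpha>\<close> is the point
  where both give the same order.\<close>

section \<open>Riesz representation and adjoints\<close>

text \<open>The representing vector minimizes \<open>x \<bullet> x - 2 * l x\<close>.\<close>

lemma riesz_representation:
  fixes l :: "'a::{real_inner, complete_space} \<Rightarrow> real"
  assumes "bounded_linear l"
  shows "\<exists>y. \<forall>z. y \<bullet> z = l z"
proof -
  interpret bounded_linear l by fact
  obtain K where K: "\<And>x. \<bar>l x\<bar> \<le> norm x * K" using bounded by auto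
  define J where "J x = x \<bullet> x - 2 * l x" for x
  have below: "- (K\<^sup>2) \<le> J x" for x
  proof -
    have "0 \<le> (norm x - K)\<^sup>2" by simp
    also have "\<dots> = x \<bullet> x - 2 * (norm x * K) + K\<^sup>2"
      by (simp add: power2_diff power2_norm_eq_inner)
    finally show ?thesis using K[of x] by (simp add: J_def)
  qed
  define m where "m = (INF x. J x)"
  have bdd: "bdd_below (range J)" using below by (auto intro!: bdd_belowI)
  have m: "m \<le> J x" for x unfolding m_def by (rule cINF_lower[OF bdd]) simp
  have "\<exists>x. J x < m + 1 / Suc n" for n :: nat
    using cInf_lessD[of "range J" "m + 1 / Suc n"] by (auto simp: m_def)
  then obtain X where X: "\<And>n::nat. J (X n) < m + 1 / Suc n" by metis
  \<comment> \<open>Parallelogram law for \<open>J\<close>, the linear terms cancelling. As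
    \<open>J\<close> at the midpoint is at least \<open>m\<close>, almost minimizing vectors are
    close to each other.\<close>
  have par: "(norm (x - y))\<^sup>2 = 2 * J x + 2 * J y - 4 * J ((1/2) *\<^sub>R (x + y))" for x y
    unfolding J_def power2_norm_eq_inner
    by (simp add: add scaleR inner_simps inner_commute algebra_simps)
  have "Cauchy X"
  proof (rule CauchyI)
    fix e :: real assume "e > 0"
    \<comment> \<open>Two excesses over \<open>m\<close> below \<open>e\<^sup>2 / 4\<close>, each
      counted twice in \<open>par\<close>, add up to \<open>e\<^sup>2\<close>.\<close>
    obtain N :: nat where N: "4 / e\<^sup>2 < real N" using reals_Archimedean2 by blast
    have "norm (X i - X j) < e" if "i \<ge> N" "j \<ge> N" for i j
    proof -
      have small: "1 / real (Suc k) < e\<^sup>2 / 4" if "k \<ge> N" for k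
      proof -
        have "4 / e\<^sup>2 < real (Suc k)" using N that by linarith
        then show ?thesis using \<open>e > 0\<close> by (simp add: field_simps)
      qed
      have "(norm (X i - X j))\<^sup>2 \<le> 2 * J (X i) + 2 * J (X j) - 4 * m"
        using par[of "X i" "X j"] m[of "(1/2) *\<^sub>R (X i + X j)"] by linarith
      also have "\<dots> < e\<^sup>2"
        using X[of i] X[of j] small[OF that(1)] small[OF that(2)] by linarith
      finally show ?thesis using \<open>e > 0\<close> by (simp add: power2_less_imp_less)
    qed
    then show "\<exists>M. \<forall>i\<ge>M. \<forall>j\<ge>M. norm (X i - X j) < e" by blast
  qed
  then obtain y where y: "X \<longlonglongrightarrow> y" using Cauchy_convergent_iff convergent_def by blast
  have "(\<lambda>n. J (X n)) \<longlonglongrightarrow> J y"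
    unfolding J_def by (intro tendsto_intros tendsto y)
  moreover have "(\<lambda>n::nat. m + 1 / Suc n) \<longlonglongrightarrow> m + 0"
    by (intro tendsto_intros LIMSEQ_Suc[OF lim_1_over_n])
  ultimately have Jy: "J y \<le> m + 0"
    using X by (intro LIMSEQ_le) (auto intro: less_imp_le)
  have "y \<bullet> z = l z" for z
  proof (rule ccontr)
    assume ne: "y \<bullet> z \<noteq> l z"
    define d where "d = y \<bullet> z - l z"
    have "z \<noteq> 0" using ne zero by auto
    then have zz: "z \<bullet> z > 0" by simp
    \<comment> \<open>The minimizer of the quadratic polynomial \<open>J (y + s *\<^sub>R z)\<close>
      in \<open>s\<close>; it lowers \<open>J\<close> by
      \<open>d * d / (z \<bullet> z)\<close>.\<close>
    define s where "s = - d / (z \<bullet> z)"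
    have "J (y + s *\<^sub>R z) = J y + 2 * s * d + s * s * (z \<bullet> z)"
      unfolding J_def d_def by (simp add: add scaleR inner_simps inner_commute algebra_simps)
    also have "\<dots> = J y - d * d / (z \<bullet> z)" using zz by (simp add: s_def field_simps)
    also have "\<dots> < J y" using ne zz zero_less_mult_iff[of d d] by (auto simp: d_def)
    finally show False using m[of "y + s *\<^sub>R z"] Jy by simp
  qed
  then show ?thesis by blast
qed

text \<open>\<open>adjoint\<close> is a Hilbert choice, so it has its characteristic property only
  once some map with that property exists. Riesz representation provides one, vector by
  vector.\<close>

lemma adjoint_inner:
  fixes A :: "'a::{real_inner, complete_space} \<Rightarrow> 'b::real_inner"
  assumes "bounded_linear A"
  shows "A x \<bullet> y = x \<bullet> adjoint A y"
proof -
  have "\<exists>u. \<forall>x. u \<bullet> x = A x \<bullet> y" for y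
    by (rule riesz_representation)
       (rule bounded_linear_compose[OF bounded_linear_inner_left assms])
  then obtain F where "\<And>x y. A x \<bullet> y = x \<bullet> F y" by (metis inner_commute)
  then have "\<exists>F. \<forall>x y. A x \<bullet> y = x \<bullet> F y" by blast
  from someI_ex[OF this] show ?thesis unfolding adjoint_def by blast
qed

section \<open>Bounded Borel functional calculus\<close>

definition bounded_borel :: "(real \<Rightarrow> real) \<Rightarrow> bool" where
  "bounded_borel \<phi> \<longleftrightarrow> \<phi> \<in> borel_measurable borel \<and> (\<exists>C. \<forall>t. \<bar>\<phi> t\<bar> \<le> C)"

lemma bounded_borelI:
  "\<phi> \<in> borel_measurable borel \<Longrightarrow> (\<And>t. \<bar>\<phi> t\<bar> \<le> C) \<Longrightarrow> bounded_borel \<phi>"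
  by (auto simp: bounded_borel_def)

lemma bounded_borel_measurable: "bounded_borel \<phi> \<Longrightarrow> \<phi> \<in> borel_measurable borel"
  by (simp add: bounded_borel_def)

lemma bounded_borel_indicator [simp]: "T \<in> sets borel \<Longrightarrow> bounded_borel (indicator T)"
  by (rule bounded_borelI[of _ 1]) (auto simp: indicator_def)

lemma bounded_borel_const [simp]: "bounded_borel (\<lambda>t. c)"
  by (rule bounded_borelI[of _ "\<bar>c\<bar>"]) auto

lemma bounded_borel_mult [simp]:
  assumes "bounded_borel \<phi>" "bounded_borel \<eta>"
  shows "bounded_borel (\<lambda>t. \<phi> t * \<eta> t)"
proof -
  obtain C D where "\<And>t. \<bar>\<phi> t\<bar> \<le> C" "\<And>t. \<bar>\<eta> t\<bar> \<le> D"
    using assms by (auto simp: bounded_borel_def)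
  then have "\<bar>\<phi> t * \<eta> t\<bar> \<le> C * D" for t
    unfolding abs_mult by (meson abs_ge_zero mult_mono order_trans)
  then show ?thesis
    using assms by (intro bounded_borelI[of _ "C * D"]) (auto simp: bounded_borel_def)
qed

lemma bounded_borel_add [simp]:
  assumes "bounded_borel \<phi>" "bounded_borel \<eta>"
  shows "bounded_borel (\<lambda>t. \<phi> t + \<eta> t)"
proof -
  obtain C D where "\<And>t. \<bar>\<phi> t\<bar> \<le> C" "\<And>t. \<bar>\<eta> t\<bar> \<le> D"
    using assms by (auto simp: bounded_borel_def)
  then have "\<bar>\<phi> t + \<eta> t\<bar> \<le> C + D" for t
    by (meson abs_triangle_ineq add_mono order_trans)
  then show ?thesis
    using assms by (intro bounded_borelI[of _ "C + D"]) (auto simp: bounded_borel_def)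
qed

lemma bounded_borel_diff [simp]:
  assumes "bounded_borel \<phi>" "bounded_borel \<eta>"
  shows "bounded_borel (\<lambda>t. \<phi> t - \<eta> t)"
  using bounded_borel_add[OF assms(1) bounded_borel_mult[OF bounded_borel_const[of "-1"] assms(2)]]
  by simp

lemma bounded_borel_power [simp]: "bounded_borel \<phi> \<Longrightarrow> bounded_borel (\<lambda>t. (\<phi> t) ^ n)"
  by (induction n) auto

lemma bounded_borel_integrable:
  assumes "bounded_borel \<phi>" "finite_measure M" "sets M = sets borel"
  shows "integrable M \<phi>"
proof -
  interpret finite_measure M by fact
  obtain C where "\<And>t. \<bar>\<phi> t\<bar> \<le> C" using assms by (auto simp: bounded_borel_def)
  moreover have "\<phi> \<in> borel_measurable M"
    using assms(1) by (simp add: bounded_borel_def measurable_cong_sets[OF assms(3) refl])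
  ultimately show ?thesis by (intro integrable_const_bound[of _ C]) auto
qed

text \<open>
  Bilinearity and multiplicativity of the functional calculus are linear relations between
  integrals of \<open>\<phi>\<close> against finitely many measures, so they need only be checked on indicators.
\<close>

lemma sum_integral_eq_0_of_indicator:
  fixes M :: "'i \<Rightarrow> real measure"
  assumes "finite I"
    and fin: "\<And>i. i \<in> I \<Longrightarrow> finite_measure (M i)" and sets: "\<And>i. i \<in> I \<Longrightarrow> sets (M i) = sets borel"
    and w: "\<And>i. i \<in> I \<Longrightarrow> bounded_borel (w i)"
    and ind: "\<And>T. T \<in> sets borel \<Longrightarrow> (\<Sum>i\<in>I. \<integral>t. indicator T t * w i t \<partial>M i) = 0"
    and \<phi>: "bounded_borel \<phi>"
  shows "(\<Sum>i\<in>I. \<integral>t. \<phi> t * w i t \<partial>M i) = 0"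
proof -
  have int: "integrable (M i) (\<lambda>t. s t * w i t)" if "i \<in> I" "bounded_borel s" for i s
    using that w fin sets by (intro bounded_borel_integrable) auto
  obtain C where C: "\<And>t. \<bar>\<phi> t\<bar> \<le> C" using \<phi> by (auto simp: bounded_borel_def)
  obtain F where F: "\<And>n. simple_function borel (F n)" "\<And>t. (\<lambda>n. F n t) \<longlonglongrightarrow> \<phi> t"
    "\<And>n t. dist (F n t) 0 \<le> 2 * dist (\<phi> t) 0"
    using borel_measurable_implies_sequence_metric[OF bounded_borel_measurable[OF \<phi>], of 0] by auto
  have F_le: "\<bar>F n t\<bar> \<le> 2 * C" for n t
    using F(3)[of n t] C[of t] by simp
  have bb: "bounded_borel s" if "simple_function borel s" for s
  proof -
    have "finite (range s)" using simple_functionD(1)[OF that] by simp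
    then obtain D where "\<And>t. \<bar>s t\<bar> \<le> D"
      using finite_imp_bounded[of "range s"] by (auto simp: bounded_iff)
    then show ?thesis
      using borel_measurable_simple_function[OF that] by (intro bounded_borelI)
  qed
  have "(\<Sum>i\<in>I. \<integral>t. s t * w i t \<partial>M i) = 0" if s: "simple_function borel s" for s
  proof -
    have fin: "finite (range s)" and pre: "s -` {v} \<in> sets borel" for v
      using simple_functionD[OF s] by auto
    have s_eq: "s t = (\<Sum>v\<in>range s. v * indicator (s -` {v}) t)" for t
      using fin by (subst sum.remove[of _ "s t"]) (auto simp: indicator_def intro!: sum.neutral)
    have "(\<Sum>i\<in>I. \<integral>t. s t * w i t \<partial>M i)
        = (\<Sum>i\<in>I. \<Sum>v\<in>range s. v * (\<integral>t. indicator (s -` {v}) t * w i t \<partial>M i))"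
    proof (rule sum.cong[OF refl])
      fix i assume i: "i \<in> I"
      have "(\<integral>t. s t * w i t \<partial>M i) = (\<integral>t. (\<Sum>v\<in>range s. v * (indicator (s -` {v}) t * w i t)) \<partial>M i)"
        by (subst s_eq) (simp add: sum_distrib_right mult.assoc)
      also have "\<dots> = (\<Sum>v\<in>range s. v * (\<integral>t. indicator (s -` {v}) t * w i t \<partial>M i))"
        using int[OF i] pre by (subst Bochner_Integration.integral_sum) auto
      finally show "(\<integral>t. s t * w i t \<partial>M i) = (\<Sum>v\<in>range s. v * (\<integral>t. indicator (s -` {v}) t * w i t \<partial>M i))" .
    qed
    also have "\<dots> = (\<Sum>v\<in>range s. v * (\<Sum>i\<in>I. \<integral>t. indicator (s -` {v}) t * w i t \<partial>M i))"
      by (subst sum.swap) (simp add: sum_distrib_left)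
    also have "\<dots> = 0" by (simp add: ind[OF pre])
    finally show ?thesis .
  qed
  then have zero: "(\<Sum>i\<in>I. \<integral>t. F n t * w i t \<partial>M i) = 0" for n using F(1) by blast
  have "(\<lambda>n. \<integral>t. F n t * w i t \<partial>M i) \<longlonglongrightarrow> (\<integral>t. \<phi> t * w i t \<partial>M i)" if i: "i \<in> I" for i
  proof -
    note m = measurable_cong_sets[OF sets[OF i] refl]
    obtain D where D: "\<And>t. \<bar>w i t\<bar> \<le> D" using w[OF i] by (auto simp: bounded_borel_def)
    interpret finite_measure "M i" using fin[OF i] .
    show ?thesis
    proof (rule integral_dominated_convergence[where w = "\<lambda>_. 2 * C * D"])
      show "(\<lambda>t. \<phi> t * w i t) \<in> borel_measurable (M i)"
        using int[OF i \<phi>] by (rule borel_measurable_integrable)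
      show "(\<lambda>t. F n t * w i t) \<in> borel_measurable (M i)" for n
        using int[OF i bb[OF F(1)]] by (rule borel_measurable_integrable)
      show "integrable (M i) (\<lambda>_. 2 * C * D)" by simp
      show "AE t in M i. (\<lambda>n. F n t * w i t) \<longlonglongrightarrow> \<phi> t * w i t"
        by (intro AE_I2 tendsto_intros F)
      show "AE t in M i. norm (F n t * w i t) \<le> 2 * C * D" for n
      proof (rule AE_I2)
        fix t
        show "norm (F n t * w i t) \<le> 2 * C * D"
          using mult_mono[OF F_le[of n t] D[of t]] F_le[of n t] D[of t] by (simp add: abs_mult)
      qed
    qed
  qed
  then have "(\<lambda>n. \<Sum>i\<in>I. \<integral>t. F n t * w i t \<partial>M i) \<longlonglongrightarrow> (\<Sum>i\<in>I. \<integral>t. \<phi> t * w i t \<partial>M i)"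
    by (rule tendsto_sum)
  then show ?thesis by (simp add: zero LIMSEQ_const_iff)
qed

section \<open>Projection-valued measures and the positive measures of single vectors\<close>

locale pvm =
  fixes E :: "real set \<Rightarrow> 'a::{real_inner, complete_space} \<Rightarrow> 'a"
  assumes projection_valued_measure: "projection_valued_measure E"
begin

abbreviation \<mu> :: "'a \<Rightarrow> real measure" where "\<mu> x \<equiv> scalar_spectral_measure E x"

lemma E_linear: "T \<in> sets borel \<Longrightarrow> bounded_linear (E T)"
  and E_selfadjoint: "T \<in> sets borel \<Longrightarrow> E T x \<bullet> y = x \<bullet> E T y"
  and E_UNIV [simp]: "E UNIV x = x"
  and E_Int: "S \<in> sets borel \<Longrightarrow> T \<in> sets borel \<Longrightarrow> E (S \<inter> T) x = E S (E T x)"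
  and E_sums: "range F \<subseteq> sets borel \<Longrightarrow> disjoint_family F \<Longrightarrow> (\<lambda>n. E (F n) x) sums E (\<Union>n. F n) x"
  using projection_valued_measure unfolding projection_valued_measure_def by blast+

lemma E_add: "T \<in> sets borel \<Longrightarrow> E T (x + y) = E T x + E T y"
  and E_diff: "T \<in> sets borel \<Longrightarrow> E T (x - y) = E T x - E T y"
  using E_linear[of T] by (simp_all add: linear_simps)

lemma E_idem: "T \<in> sets borel \<Longrightarrow> E T (E T x) = E T x"
  using E_Int[of T T x] by simp

lemma inner_E: "T \<in> sets borel \<Longrightarrow> x \<bullet> E T x = (norm (E T x))\<^sup>2"
  by (metis E_idem E_selfadjoint power2_norm_eq_inner)

text \<open>Repeating the empty set gives a disjoint family, and a convergent series with constant
  terms has zero terms.\<close>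

lemma E_empty [simp]: "E {} x = 0"
proof -
  have "(\<lambda>n::nat. E {} x) sums E {} x"
    using E_sums[of "\<lambda>_. {}" x] by (simp add: disjoint_family_on_def)
  then have "(\<lambda>n::nat. E {} x) \<longlonglongrightarrow> 0" using summable_LIMSEQ_zero sums_summable by blast
  then show ?thesis by (simp add: LIMSEQ_const_iff)
qed

lemma sets_\<mu> [simp, measurable_cong]: "sets (\<mu> x) = sets borel"
  and space_\<mu> [simp]: "space (\<mu> x) = UNIV"
  using sets.sigma_sets_eq[of "borel :: real measure"]
  by (auto simp: scalar_spectral_measure_def space_measure_of_conv)

text \<open>\<open>measure_of\<close> takes the prescribed values only for a countably additive set
  function. Here additivity is the strong convergence in \<open>E_sums\<close>, tested against
  \<open>x\<close>.\<close>

lemma emeasure_\<mu>: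
  assumes T: "T \<in> sets borel"
  shows "emeasure (\<mu> x) T = ennreal (x \<bullet> E T x)"
proof -
  have pos: "positive (sets (\<mu> x)) (\<lambda>S. ennreal (x \<bullet> E S x))"
    by (simp add: positive_def)
  have ca: "countably_additive (sets (\<mu> x)) (\<lambda>S. ennreal (x \<bullet> E S x))"
  proof (rule countably_additiveI)
    fix F :: "nat \<Rightarrow> real set"
    assume F: "range F \<subseteq> sets (\<mu> x)" "disjoint_family F"
    then have F': "range F \<subseteq> sets borel" by simp
    have sums: "(\<lambda>n. x \<bullet> E (F n) x) sums (x \<bullet> E (\<Union>n. F n) x)"
      by (rule bounded_linear.sums[OF bounded_linear_inner_right E_sums[OF F' F(2)]])
    have "0 \<le> x \<bullet> E (F n) x" for n
      using inner_E[of "F n" x] F' by (simp add: range_subsetD)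
    then show "(\<Sum>n. ennreal (x \<bullet> E (F n) x)) = ennreal (x \<bullet> E (\<Union>n. F n) x)"
      unfolding sums_unique[OF sums] by (rule suminf_ennreal2[OF _ sums_summable[OF sums]])
  qed
  show ?thesis
    by (rule emeasure_measure_of[OF scalar_spectral_measure_def]) (simp_all add: T pos[simplified] ca[simplified])
qed

lemma measure_\<mu>: "T \<in> sets borel \<Longrightarrow> measure (\<mu> x) T = x \<bullet> E T x"
  by (simp add: measure_def emeasure_\<mu> inner_E)

lemma measure_\<mu>_UNIV: "measure (\<mu> x) UNIV = (norm x)\<^sup>2"
  by (simp add: measure_\<mu> power2_norm_eq_inner)

lemma finite_measure_\<mu>: "finite_measure (\<mu> x)"
  by (rule finite_measureI) (simp add: emeasure_\<mu>)

lemma integrable_\<mu>: "bounded_borel \<phi> \<Longrightarrow> integrable (\<mu> x) \<phi>"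
  by (intro bounded_borel_integrable finite_measure_\<mu>) auto

text \<open>The finite index set becomes the positions in a list, so a relation can be written as a
  concrete list of weights and vectors, repetitions allowed.\<close>

lemma integral_relation:
  assumes "\<And>w x. (w, x) \<in> set L \<Longrightarrow> bounded_borel w"
    and "\<And>T. T \<in> sets borel \<Longrightarrow> (\<Sum>(w, x)\<leftarrow>L. \<integral>t. indicator T t * w t \<partial>\<mu> x) = 0"
    and "bounded_borel \<phi>"
  shows "(\<Sum>(w, x)\<leftarrow>L. \<integral>t. \<phi> t * w t \<partial>\<mu> x) = 0"
proof -
  have *: "(\<Sum>(w, x)\<leftarrow>L. \<integral>t. s t * w t \<partial>\<mu> x) =
      (\<Sum>i\<in>{0..<length L}. \<integral>t. s t * fst (L ! i) t \<partial>\<mu> (snd (L ! i)))" for s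
    by (simp add: sum_list_sum_nth case_prod_beta)
  show ?thesis unfolding *
  proof (rule sum_integral_eq_0_of_indicator)
    show "bounded_borel (fst (L ! i))" if "i \<in> {0..<length L}" for i
      by (rule assms(1)[of _ "snd (L ! i)"]) (use that in simp)
  qed (use assms(2,3) in \<open>simp_all add: finite_measure_\<mu> *[symmetric]\<close>)
qed

text \<open>With constant weights, the case of an indicator is an algebraic identity between the
  quadratic forms \<open>x \<bullet> E T x\<close>.\<close>

lemma integral_linear_relation:
  assumes "\<And>T. T \<in> sets borel \<Longrightarrow> (\<Sum>(c, x)\<leftarrow>L. c * (x \<bullet> E T x)) = 0" "bounded_borel \<phi>"
  shows "(\<Sum>(c, x)\<leftarrow>L. c * integral\<^sup>L (\<mu> x) \<phi>) = 0"
proof -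
  let ?L = "map (\<lambda>(c, x). (\<lambda>t. c, x)) L"
  have eq: "(\<Sum>(w, x)\<leftarrow>?L. \<integral>t. s t * w t \<partial>\<mu> x) = (\<Sum>(c, x)\<leftarrow>L. c * integral\<^sup>L (\<mu> x) s)" for s
    by (simp add: comp_def case_prod_unfold mult.commute[of _ "fst _"])
  have "(\<Sum>(w, x)\<leftarrow>?L. \<integral>t. \<phi> t * w t \<partial>\<mu> x) = 0"
  proof (rule integral_relation[OF _ _ assms(2)])
    show "bounded_borel w" if "(w, x) \<in> set ?L" for w x
      using that by auto
    fix T :: "real set" assume "T \<in> sets borel"
    then show "(\<Sum>(w, x)\<leftarrow>?L. \<integral>t. indicator T t * w t \<partial>\<mu> x) = 0"
      unfolding eq using assms(1) by (simp add: measure_\<mu>)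
  qed
  then show ?thesis unfolding eq .
qed

text \<open>The integral of \<open>\<phi>\<close> against \<open>\<langle>E x, z\<rangle>\<close> by
  polarization, as in the graph of \<open>spectral_integral\<close>. Linearity in \<open>z\<close>
  is not visible here, because \<open>z\<close> enters through the measures.\<close>

definition form :: "(real \<Rightarrow> real) \<Rightarrow> 'a \<Rightarrow> 'a \<Rightarrow> real" where
  "form \<phi> x z = (integral\<^sup>L (\<mu> (x + z)) \<phi> - integral\<^sup>L (\<mu> (x - z)) \<phi>) / 4"

lemma inner_E_commute: "T \<in> sets borel \<Longrightarrow> y \<bullet> E T x = x \<bullet> E T y"
  by (metis E_selfadjoint inner_commute)

lemma quadratic_E_add:
  assumes "T \<in> sets borel"
  shows "(x + y) \<bullet> E T (x + y) = x \<bullet> E T x + y \<bullet> E T y + 2 * (x \<bullet> E T y)"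
  unfolding E_add[OF assms] inner_add_left inner_add_right inner_E_commute[OF assms, of y x] by simp

lemma quadratic_E_diff:
  assumes "T \<in> sets borel"
  shows "(x - y) \<bullet> E T (x - y) = x \<bullet> E T x + y \<bullet> E T y - 2 * (x \<bullet> E T y)"
  unfolding E_diff[OF assms] inner_diff_left inner_diff_right inner_E_commute[OF assms, of y x] by simp

lemma form_indicator:
  assumes "T \<in> sets borel" shows "form (indicator T) x z = E T x \<bullet> z"
  by (simp add: form_def measure_\<mu> quadratic_E_add quadratic_E_diff assms E_selfadjoint)

lemma form_commute:
  assumes "bounded_borel \<phi>" shows "form \<phi> x z = form \<phi> z x"
proof -
  have "(\<Sum>(c, x)\<leftarrow>[(1, x - z), (-1, z - x)]. c * integral\<^sup>L (\<mu> x) \<phi>) = 0"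
    by (rule integral_linear_relation[OF _ assms])
       (simp add: quadratic_E_diff inner_E_commute[of _ x z])
  then show ?thesis by (simp add: form_def add.commute)
qed

lemma diff_quadratic_E:
  assumes "T \<in> sets borel"
  shows "(x + z) \<bullet> E T (x + z) - (x - z) \<bullet> E T (x - z) = 4 * (E T x \<bullet> z)"
  using form_indicator[OF assms, of x z] by (simp add: form_def measure_\<mu> assms)

lemma form_add:
  assumes "bounded_borel \<phi>" shows "form \<phi> x (z + y) = form \<phi> x z + form \<phi> x y"
proof -
  \<comment> \<open>On an indicator each consecutive pair of entries yields, up to sign, four times
    \<open>E T x \<bullet> _\<close>; additivity is then that of the inner product.\<close>
  have "(\<Sum>(c, x)\<leftarrow>[(1, x + (z + y)), (-1, x - (z + y)), (-1, x + z), (1, x - z), (-1, x + y), (1, x - y)].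
      c * integral\<^sup>L (\<mu> x) \<phi>) = 0"
  proof (rule integral_linear_relation[OF _ assms])
    fix T :: "real set" assume "T \<in> sets borel"
    note this[THEN diff_quadratic_E, of x]
    from this[of "z + y"] this[of z] this[of y] inner_add_right[of "E T x" z y]
    show "(\<Sum>(c, x)\<leftarrow>[(1, x + (z + y)), (-1, x - (z + y)), (-1, x + z), (1, x - z), (-1, x + y), (1, x - y)].
      c * (x \<bullet> E T x)) = 0"
      by simp
  qed
  then show ?thesis by (simp add: form_def field_simps)
qed

lemma form_scaleR:
  assumes "bounded_borel \<phi>" shows "form \<phi> x (a *\<^sub>R z) = a * form \<phi> x z"
proof -
  have "(\<Sum>(c, x)\<leftarrow>[(1, x + a *\<^sub>R z), (-1, x - a *\<^sub>R z), (-a, x + z), (a, x - z)].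
      c * integral\<^sup>L (\<mu> x) \<phi>) = 0"
  proof (rule integral_linear_relation[OF _ assms])
    fix T :: "real set" assume "T \<in> sets borel"
    note * = this[THEN diff_quadratic_E, of x]
    have "a * ((x + z) \<bullet> E T (x + z)) - a * ((x - z) \<bullet> E T (x - z)) = a * (4 * (E T x \<bullet> z))"
      by (simp only: right_diff_distrib[symmetric] *)
    with *[of "a *\<^sub>R z"] inner_scaleR_right[of "E T x" a z]
    show "(\<Sum>(c, x)\<leftarrow>[(1, x + a *\<^sub>R z), (-1, x - a *\<^sub>R z), (-a, x + z), (a, x - z)].
      c * (x \<bullet> E T x)) = 0"
      by simp
  qed
  then have "integral\<^sup>L (\<mu> (x + a *\<^sub>R z)) \<phi> - integral\<^sup>L (\<mu> (x - a *\<^sub>R z)) \<phi>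
      = a * (integral\<^sup>L (\<mu> (x + z)) \<phi> - integral\<^sup>L (\<mu> (x - z)) \<phi>)"
    by (simp add: algebra_simps)
  then show ?thesis unfolding form_def by simp
qed

lemma form_diag:
  assumes "bounded_borel \<phi>" shows "form \<phi> x x = integral\<^sup>L (\<mu> x) \<phi>"
proof -
  have "(\<Sum>(c, x)\<leftarrow>[(1, x + x), (-1, x - x), (-4, x)]. c * integral\<^sup>L (\<mu> x) \<phi>) = 0"
    by (rule integral_linear_relation[OF _ assms])
       (simp add: quadratic_E_add quadratic_E_diff)
  then show ?thesis by (simp add: form_def field_simps)
qed

lemma integral_\<mu>_le:
  assumes "bounded_borel \<phi>" "\<And>t. \<phi> t \<le> C"
  shows "integral\<^sup>L (\<mu> x) \<phi> \<le> C * (norm x)\<^sup>2"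
proof -
  interpret finite_measure "\<mu> x" by (rule finite_measure_\<mu>)
  have "integral\<^sup>L (\<mu> x) \<phi> \<le> (\<integral>t. C \<partial>\<mu> x)"
    using assms by (intro integral_mono integrable_\<mu>) auto
  then show ?thesis by (simp add: measure_\<mu>_UNIV mult.commute)
qed

lemma bounded_linear_form:
  assumes \<phi>: "bounded_borel \<phi>" shows "bounded_linear (form \<phi> x)"
proof -
  obtain C where C: "\<And>t. \<bar>\<phi> t\<bar> \<le> C" using \<phi> by (auto simp: bounded_borel_def)
  have int: "\<bar>integral\<^sup>L (\<mu> x) \<phi>\<bar> \<le> C * (norm x)\<^sup>2" for x
  proof -
    have "integral\<^sup>L (\<mu> x) \<phi> \<le> C * (norm x)\<^sup>2"
      using C by (intro integral_\<mu>_le[OF \<phi>]) (metis abs_le_D1)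
    moreover have "integral\<^sup>L (\<mu> x) (\<lambda>t. (-1) * \<phi> t) \<le> C * (norm x)\<^sup>2"
      using C \<phi> by (intro integral_\<mu>_le bounded_borel_mult) (auto simp: abs_le_iff)
    ultimately show ?thesis by simp
  qed
  show ?thesis
  proof (rule bounded_linear_intro)
    show "form \<phi> x (y + z) = form \<phi> x y + form \<phi> x z" for y z by (rule form_add[OF \<phi>])
    show "form \<phi> x (a *\<^sub>R z) = a *\<^sub>R form \<phi> x z" for a z by (simp add: form_scaleR[OF \<phi>])
    show "norm (form \<phi> x z) \<le> norm z * (C * ((norm x)\<^sup>2 + 1) / 2)" for z
    proof (cases "z = 0")
      case True
      then show ?thesis using form_scaleR[OF \<phi>, of x 0 0] by simp
    next
      case False
      \<comment> \<open>The bound is found at a unit vector, where the parallelogram law evaluates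
        the two squared norms, and is carried to \<open>z\<close> by homogeneity. A constant
        depending on the fixed \<open>x\<close> suffices for Riesz representation.\<close>
      define u where "u = (1 / norm z) *\<^sub>R z"
      have u: "norm u = 1" "z = norm z *\<^sub>R u" using False by (auto simp: u_def)
      have "\<bar>form \<phi> x u\<bar> \<le> (C * (norm (x + u))\<^sup>2 + C * (norm (x - u))\<^sup>2) / 4"
        using int[of "x + u"] int[of "x - u"] unfolding form_def by (simp add: abs_le_iff)
      also have "\<dots> = C * ((norm x)\<^sup>2 + (norm u)\<^sup>2) / 2"
        unfolding power2_norm_eq_inner by (simp add: inner_simps inner_commute algebra_simps)
      finally have "\<bar>form \<phi> x u\<bar> \<le> C * ((norm x)\<^sup>2 + 1) / 2" by (simp add: u)
      from mult_left_mono[OF this norm_ge_zero[of z]] show ?thesis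
        by (subst u(2)) (simp add: form_scaleR[OF \<phi>] abs_mult)
    qed
  qed
qed

text \<open>\<open>\<integral> \<phi> dE\<close> for bounded Borel \<open>\<phi>\<close>.\<close>

definition calc :: "(real \<Rightarrow> real) \<Rightarrow> 'a \<Rightarrow> 'a" where
  "calc \<phi> x = (SOME y. \<forall>z. y \<bullet> z = form \<phi> x z)"

lemma inner_calc:
  assumes "bounded_borel \<phi>" shows "calc \<phi> x \<bullet> z = form \<phi> x z"
  using someI_ex[OF riesz_representation[OF bounded_linear_form[OF assms, of x]]]
  unfolding calc_def by blast

lemma calc_eqI:
  assumes "bounded_borel \<phi>" "\<And>z. y \<bullet> z = form \<phi> x z" shows "calc \<phi> x = y"
  by (metis assms inner_calc vector_eq_rdot)

lemma calc_selfadjoint: "bounded_borel \<phi> \<Longrightarrow> calc \<phi> x \<bullet> z = x \<bullet> calc \<phi> z"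
  by (metis form_commute inner_calc inner_commute)

lemma calc_arg_add: "bounded_borel \<phi> \<Longrightarrow> calc \<phi> (x + y) = calc \<phi> x + calc \<phi> y"
  and calc_arg_diff: "bounded_borel \<phi> \<Longrightarrow> calc \<phi> (x - y) = calc \<phi> x - calc \<phi> y"
  by (rule vector_eq_rdot[THEN iffD1], simp add: calc_selfadjoint inner_simps)+

lemma calc_indicator: "T \<in> sets borel \<Longrightarrow> calc (indicator T) x = E T x"
  by (rule calc_eqI) (auto simp: form_indicator)

lemma calc_add:
  assumes "bounded_borel \<phi>" "bounded_borel \<eta>"
  shows "calc (\<lambda>t. \<phi> t + \<eta> t) x = calc \<phi> x + calc \<eta> x"
  using assms
  by (intro calc_eqI) (auto simp: inner_simps inner_calc form_def integrable_\<mu> add_divide_distrib diff_divide_distrib)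

lemma calc_diff:
  assumes "bounded_borel \<phi>" "bounded_borel \<eta>"
  shows "calc (\<lambda>t. \<phi> t - \<eta> t) x = calc \<phi> x - calc \<eta> x"
  using assms
  by (intro calc_eqI) (auto simp: inner_simps inner_calc form_def integrable_\<mu> add_divide_distrib diff_divide_distrib)

text \<open>The projections multiply by intersection and commute, so
  \<open>E T x \<bullet> E R (E T x)\<close> collapses to
  \<open>x \<bullet> E (T \<inter> R) x\<close>. Truncating a vector thus cuts off its
  measure.\<close>

lemma \<mu>_E:
  assumes T: "T \<in> sets borel"
  shows "\<mu> (E T x) = density (\<mu> x) (indicator T)"
proof (rule measure_eqI)
  fix R assume "R \<in> sets (\<mu> (E T x))"
  then have R: "R \<in> sets borel" by simp
  have "E T x \<bullet> E R (E T x) = x \<bullet> E (T \<inter> R) x"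
    using T R by (metis E_Int E_selfadjoint E_idem inf_commute)
  moreover have "emeasure (density (\<mu> x) (indicator T)) R = emeasure (\<mu> x) (T \<inter> R)"
    using T R by (simp add: emeasure_density indicator_inter_arith[symmetric])
  ultimately show "emeasure (\<mu> (E T x)) R = emeasure (density (\<mu> x) (indicator T)) R"
    using T R by (simp add: emeasure_\<mu>)
qed (simp add: T)

lemma integral_\<mu>_E:
  fixes \<phi> :: "real \<Rightarrow> real"
  assumes "T \<in> sets borel" "\<phi> \<in> borel_measurable borel"
  shows "integral\<^sup>L (\<mu> (E T x)) \<phi> = (\<integral>t. indicator T t * \<phi> t \<partial>\<mu> x)"
  using assms integral_density[of \<phi> "\<mu> x" "indicator T"]
  by (simp add: \<mu>_E ennreal_indicator)

lemma integrable_\<mu>_E: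
  fixes \<phi> :: "real \<Rightarrow> real"
  assumes "T \<in> sets borel" "\<phi> \<in> borel_measurable borel"
  shows "integrable (\<mu> (E T x)) \<phi> \<longleftrightarrow> integrable (\<mu> x) (\<lambda>t. indicator T t * \<phi> t)"
  using assms integrable_density[of \<phi> "\<mu> x" "indicator T"]
  by (simp add: \<mu>_E ennreal_indicator)

lemma form_E:
  assumes T: "T \<in> sets borel" and \<phi>: "bounded_borel \<phi>"
  shows "form \<phi> x (E T z) = form (\<lambda>t. indicator T t * \<phi> t) x z"
proof -
  have TE: "T \<inter> R \<in> sets borel" if "R \<in> sets borel" for R using that T by auto
  have c: "E T (E R y) = E R (E T y)" if "R \<in> sets borel" for R y
    using that T by (metis E_Int inf_commute)
  have "(\<Sum>(c, x)\<leftarrow>[(1, x + E T z), (-1, x - E T z), (-1, E T (x + z)), (1, E T (x - z))].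
      c * integral\<^sup>L (\<mu> x) \<phi>) = 0"
    by (rule integral_linear_relation[OF _ \<phi>])
       (simp add: T E_diff E_add E_idem E_selfadjoint inner_simps c algebra_simps)
  then show ?thesis
    using integral_\<mu>_E[OF T bounded_borel_measurable[OF \<phi>]] by (simp add: form_def)
qed

lemma E_calc:
  assumes "T \<in> sets borel" "bounded_borel \<phi>"
  shows "E T (calc \<phi> x) = calc (\<lambda>t. indicator T t * \<phi> t) x"
  using assms by (intro calc_eqI[symmetric]) (auto simp: E_selfadjoint inner_calc form_E)

lemma calc_E:
  assumes "T \<in> sets borel" "bounded_borel \<phi>"
  shows "calc \<phi> (E T x) = calc (\<lambda>t. indicator T t * \<phi> t) x"
  by (rule vector_eq_rdot[THEN iffD1])
     (metis E_calc E_selfadjoint assms bounded_borel_indicator bounded_borel_mult calc_selfadjoint)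

text \<open>For fixed \<open>\<eta>\<close> the claim is a relation in \<open>\<phi>\<close> with
  weights 1 and -1 at \<open>calc \<eta> x \<plusminus> z\<close> and weights built from
  \<open>\<eta>\<close> at \<open>x \<plusminus> z\<close>. For an indicator \<open>\<phi>\<close>
  it is \<open>E_calc\<close>; \<open>integral_relation\<close> extends it to all bounded Borel
  functions.\<close>

lemma calc_calc:
  assumes \<phi>: "bounded_borel \<phi>" and \<eta>: "bounded_borel \<eta>"
  shows "calc \<phi> (calc \<eta> x) = calc (\<lambda>t. \<phi> t * \<eta> t) x"
proof (rule calc_eqI[symmetric])
  show "bounded_borel (\<lambda>t. \<phi> t * \<eta> t)" using assms by simp
  fix z
  let ?y = "calc \<eta> x"
  have "(\<Sum>(w, x)\<leftarrow>[(\<lambda>t. 1, ?y + z), (\<lambda>t. -1, ?y - z), (\<lambda>t. - \<eta> t, x + z), (\<eta>, x - z)].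
      \<integral>t. \<phi> t * w t \<partial>\<mu> x) = 0"
  proof (rule integral_relation[OF _ _ \<phi>])
    show "bounded_borel w" if "(w, y) \<in> set [(\<lambda>t. 1, ?y + z), (\<lambda>t. -1, ?y - z), (\<lambda>t. - \<eta> t, x + z), (\<eta>, x - z)]" for w y
      using that \<eta> bounded_borel_mult[OF bounded_borel_const[of "-1"] \<eta>] by auto
    fix T :: "real set" assume T: "T \<in> sets borel"
    have "form (indicator T) ?y z = form (\<lambda>t. indicator T t * \<eta> t) x z"
      using T \<eta> by (metis E_calc bounded_borel_indicator bounded_borel_mult form_indicator inner_calc)
    then show "(\<Sum>(w, x)\<leftarrow>[(\<lambda>t. 1, ?y + z), (\<lambda>t. -1, ?y - z), (\<lambda>t. - \<eta> t, x + z), (\<eta>, x - z)].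
        \<integral>t. indicator T t * w t \<partial>\<mu> x) = 0"
      by (simp add: form_def)
  qed
  then have "form \<phi> ?y z = form (\<lambda>t. \<phi> t * \<eta> t) x z" by (simp add: form_def)
  then show "calc \<phi> ?y \<bullet> z = form (\<lambda>t. \<phi> t * \<eta> t) x z" using inner_calc[OF \<phi>] by simp
qed

text \<open>Selfadjointness moves one factor across and multiplicativity squares the function.
  Through this isometry, norm estimates and Cauchy arguments become statements about
  integrals.\<close>

lemma norm_calc_eq:
  assumes "bounded_borel \<phi>"
  shows "(norm (calc \<phi> x))\<^sup>2 = (\<integral>t. (\<phi> t)\<^sup>2 \<partial>\<mu> x)"
proof -
  have "calc \<phi> x \<bullet> calc \<phi> x = calc (\<lambda>t. \<phi> t * \<phi> t) x \<bullet> x"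
    using assms by (metis calc_calc calc_selfadjoint inner_commute)
  then show ?thesis
    using assms unfolding power2_norm_eq_inner by (simp add: inner_calc form_diag power2_eq_square)
qed

lemma norm_calc_le:
  assumes "bounded_borel \<phi>" "\<And>t. \<bar>\<phi> t\<bar> \<le> C" "C \<ge> 0"
  shows "norm (calc \<phi> x) \<le> C * norm x"
proof (rule power2_le_imp_le)
  show "(norm (calc \<phi> x))\<^sup>2 \<le> (C * norm x)\<^sup>2"
    unfolding norm_calc_eq[OF assms(1)] power_mult_distrib
    using assms by (intro integral_\<mu>_le) (auto simp: abs_le_square_iff[symmetric])
qed (use assms in simp)

section \<open>Spectral integrals of unbounded functions\<close>

lemma calc_one: "calc (\<lambda>t. 1) x = x"
  using calc_indicator[of UNIV x] by (simp add: indicator_def)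

text \<open>By the isometry, the squared distance is the integral of the indicator of the complement
  of \<open>T n\<close>, which tends to 0 by dominated convergence. The sets need not
  increase.\<close>

lemma E_tendsto:
  assumes T: "\<And>n. T n \<in> sets borel" and ev: "\<And>t. \<forall>\<^sub>F n in sequentially. t \<in> T n"
  shows "(\<lambda>n. E (T n) x) \<longlonglongrightarrow> x"
proof -
  interpret finite_measure "\<mu> x" by (rule finite_measure_\<mu>)
  have bb: "bounded_borel (\<lambda>t. 1 - indicator (T n) t)" for n using T by simp
  have "x - E (T n) x = calc (\<lambda>t. 1 - indicator (T n) t) x" for n
    using T by (simp add: calc_diff calc_one calc_indicator)
  then have eq: "(norm (x - E (T n) x))\<^sup>2 = (\<integral>t. (1 - indicator (T n) t)\<^sup>2 \<partial>\<mu> x)" for n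
    by (simp add: norm_calc_eq[OF bb])
  have "(\<lambda>n. \<integral>t. (1 - indicator (T n) t :: real)\<^sup>2 \<partial>\<mu> x) \<longlonglongrightarrow> (\<integral>t. 0 \<partial>\<mu> x)"
  proof (rule integral_dominated_convergence[where w = "\<lambda>_. 1"])
    show "AE t in \<mu> x. (\<lambda>n. (1 - indicator (T n) t)\<^sup>2 :: real) \<longlonglongrightarrow> 0"
    proof (rule AE_I2)
      fix t
      have "\<forall>\<^sub>F n in sequentially. (1 - indicator (T n) t)\<^sup>2 = (0::real)"
        using ev[of t] by eventually_elim simp
      then show "(\<lambda>n. (1 - indicator (T n) t)\<^sup>2 :: real) \<longlonglongrightarrow> 0" by (rule tendsto_eventually)
    qed
  qed (use T in \<open>auto simp: indicator_def\<close>)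
  then have "(\<lambda>n. sqrt ((norm (x - E (T n) x))\<^sup>2)) \<longlonglongrightarrow> sqrt 0"
    unfolding eq by (intro tendsto_real_sqrt) simp
  then have "(\<lambda>n. norm (E (T n) x - x)) \<longlonglongrightarrow> 0" by (simp add: norm_minus_commute)
  then show ?thesis by (rule LIM_zero_cancel[OF tendsto_norm_zero_cancel])
qed

section \<open>Truncation of unbounded functions at level \<open>n\<close>\<close>

lemma sublevel_borel [measurable]:
  fixes \<phi> :: "real \<Rightarrow> real"
  assumes "\<phi> \<in> borel_measurable borel" shows "{t. \<bar>\<phi> t\<bar> \<le> c} \<in> sets borel"
proof -
  note assms [measurable]
  have "{t \<in> space borel. \<bar>\<phi> t\<bar> \<le> c} \<in> sets borel" by measurable
  then show ?thesis by simp
qed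

lemma bounded_borel_truncation:
  assumes "\<phi> \<in> borel_measurable borel" "c \<ge> 0"
  shows "bounded_borel (\<lambda>t. indicator {t. \<bar>\<phi> t\<bar> \<le> c} t * \<phi> t)"
proof (rule bounded_borelI)
  show "(\<lambda>t. indicator {t. \<bar>\<phi> t\<bar> \<le> c} t * \<phi> t) \<in> borel_measurable borel"
    using assms sublevel_borel[OF assms(1)] by (intro borel_measurable_times borel_measurable_indicator) auto
  show "\<bar>indicator {t. \<bar>\<phi> t\<bar> \<le> c} t * \<phi> t\<bar> \<le> c" for t
    using assms by (simp add: indicator_def)
qed

lemma truncation_tendsto:
  fixes \<phi> :: "real \<Rightarrow> real"
  shows "(\<lambda>n. indicator {t. \<bar>\<phi> t\<bar> \<le> real n} t * \<phi> t) \<longlonglongrightarrow> \<phi> t"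
proof -
  have "\<forall>\<^sub>F n in sequentially. \<bar>\<phi> t\<bar> \<le> real n"
    using filterlim_real_sequentially by (simp add: filterlim_at_top)
  then have "\<forall>\<^sub>F n in sequentially. indicator {t. \<bar>\<phi> t\<bar> \<le> real n} t * \<phi> t = \<phi> t"
    by eventually_elim simp
  then show ?thesis by (rule tendsto_eventually)
qed

lemma eventually_sublevel: "\<forall>\<^sub>F n in sequentially. t \<in> {t. \<bar>\<phi> t\<bar> \<le> real n}"
  using filterlim_real_sequentially by (simp add: filterlim_at_top)

text \<open>Monotone convergence, the integrals being squared norms of truncations. It turns uniform
  norm bounds into membership in the domain of an unbounded spectral integral.\<close>

lemma square_integrableI:
  assumes \<phi>: "\<phi> \<in> borel_measurable borel"
    and le: "\<And>n. norm (calc (\<lambda>t. indicator {t. \<bar>\<phi> t\<bar> \<le> real n} t * \<phi> t) x) \<le> C"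
  shows "integrable (\<mu> x) (\<lambda>t. (\<phi> t)\<^sup>2)"
proof -
  define p where "p n t = indicator {t. \<bar>\<phi> t\<bar> \<le> real n} t * \<phi> t" for n :: nat and t
  have bb: "bounded_borel (p n)" for n
    unfolding p_def by (rule bounded_borel_truncation[OF \<phi>]) simp
  have int: "integrable (\<mu> x) (\<lambda>t. (p n t)\<^sup>2)" for n
    using bb by (intro integrable_\<mu> bounded_borel_power)
  have mono: "(p m t)\<^sup>2 \<le> (p n t)\<^sup>2" if "m \<le> n" for m n t
    using that by (auto simp: p_def indicator_def)
  have eq: "(norm (calc (p n) x))\<^sup>2 = (\<integral>t. (p n t)\<^sup>2 \<partial>\<mu> x)" for n
    by (rule norm_calc_eq[OF bb])
  have "incseq (\<lambda>n. \<integral>t. (p n t)\<^sup>2 \<partial>\<mu> x)"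
    using mono int by (intro incseq_SucI integral_mono) auto
  moreover have "(\<integral>t. (p n t)\<^sup>2 \<partial>\<mu> x) \<le> C\<^sup>2" for n
    unfolding eq[symmetric] using le[of n] by (intro power_mono) (auto simp: p_def[abs_def])
  ultimately obtain L where L: "(\<lambda>n. \<integral>t. (p n t)\<^sup>2 \<partial>\<mu> x) \<longlonglongrightarrow> L"
    using incseq_convergent by blast
  show ?thesis
  proof (rule integrable_monotone_convergence[OF int _ _ L])
    show "AE t in \<mu> x. mono (\<lambda>n. (p n t)\<^sup>2)" using mono by (auto intro!: monoI)
    show "AE t in \<mu> x. (\<lambda>n. (p n t)\<^sup>2) \<longlonglongrightarrow> (\<phi> t)\<^sup>2"
      unfolding p_def by (intro AE_I2 tendsto_power truncation_tendsto)
    show "(\<lambda>t. (\<phi> t)\<^sup>2) \<in> borel_measurable (\<mu> x)" using \<phi> by simp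
  qed
qed

lemma norm_truncation_le:
  assumes \<phi>: "\<phi> \<in> borel_measurable borel" and int: "integrable (\<mu> x) (\<lambda>t. (\<phi> t)\<^sup>2)"
  shows "norm (calc (\<lambda>t. indicator {t. \<bar>\<phi> t\<bar> \<le> real n} t * \<phi> t) x) \<le> sqrt (\<integral>t. (\<phi> t)\<^sup>2 \<partial>\<mu> x)"
proof -
  note bb = bounded_borel_truncation[OF \<phi>, of "real n"]
  have "(norm (calc (\<lambda>t. indicator {t. \<bar>\<phi> t\<bar> \<le> real n} t * \<phi> t) x))\<^sup>2 \<le> (\<integral>t. (\<phi> t)\<^sup>2 \<partial>\<mu> x)"
    unfolding norm_calc_eq[OF bb[OF of_nat_0_le_iff]]
    by (intro integral_mono integrable_\<mu> bounded_borel_power bb int) (auto simp: indicator_def)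
  then show ?thesis by (rule real_le_rsqrt)
qed

text \<open>The measures of \<open>x + z\<close> and \<open>x - z\<close> are not sums, but the
  truncated operators are linear, so the triangle inequality bounds them uniformly. Hence both
  integrals in the polarization converge on the domain.\<close>

lemma square_integrable_add:
  fixes \<phi> :: "real \<Rightarrow> real"
  assumes \<phi>: "\<phi> \<in> borel_measurable borel"
    and "integrable (\<mu> x) (\<lambda>t. (\<phi> t)\<^sup>2)" "integrable (\<mu> z) (\<lambda>t. (\<phi> t)\<^sup>2)"
  shows "integrable (\<mu> (x + z)) (\<lambda>t. (\<phi> t)\<^sup>2)" "integrable (\<mu> (x - z)) (\<lambda>t. (\<phi> t)\<^sup>2)"
proof -
  note bb = bounded_borel_truncation[OF \<phi> of_nat_0_le_iff]
  note le = norm_truncation_le[OF \<phi> assms(2)] norm_truncation_le[OF \<phi> assms(3)]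
  show "integrable (\<mu> (x + z)) (\<lambda>t. (\<phi> t)\<^sup>2)"
    by (rule square_integrableI[OF \<phi>]) (unfold calc_arg_add[OF bb], rule norm_triangle_mono[OF le])
  show "integrable (\<mu> (x - z)) (\<lambda>t. (\<phi> t)\<^sup>2)"
    by (rule square_integrableI[OF \<phi>])
       (unfold calc_arg_diff[OF bb], rule order_trans[OF norm_triangle_ineq4 add_mono[OF le]])
qed

lemma integrable_of_square:
  fixes \<phi> :: "real \<Rightarrow> real"
  assumes \<phi>: "\<phi> \<in> borel_measurable borel" and "integrable (\<mu> x) (\<lambda>t. (\<phi> t)\<^sup>2)"
  shows "integrable (\<mu> x) \<phi>"
proof (rule Bochner_Integration.integrable_bound)
  interpret finite_measure "\<mu> x" by (rule finite_measure_\<mu>)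
  show "integrable (\<mu> x) (\<lambda>t. 1 + (\<phi> t)\<^sup>2)" using assms by simp
  show "AE t in \<mu> x. norm (\<phi> t) \<le> norm (1 + (\<phi> t)\<^sup>2)"
  proof (rule AE_I2)
    fix t
    have "0 \<le> (\<bar>\<phi> t\<bar> - 1/2)\<^sup>2" by simp
    then have "\<bar>\<phi> t\<bar> \<le> 1 + (\<phi> t)\<^sup>2" by (simp add: power2_eq_square algebra_simps)
    then show "norm (\<phi> t) \<le> norm (1 + (\<phi> t)\<^sup>2)" by simp
  qed
qed (use \<phi> in simp)

text \<open>The vector is the limit of the truncated operators at \<open>x\<close>. The first
  property reduces it to the bounded calculus, the second is the weak characterization in the
  definition of \<open>spectral_integral\<close>.\<close>

lemma unbounded_calc_exists:
  assumes \<phi>: "\<phi> \<in> borel_measurable borel" and int: "integrable (\<mu> x) (\<lambda>t. (\<phi> t)\<^sup>2)"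
  shows "\<exists>u. (\<forall>T\<in>sets borel. bounded_borel (\<lambda>t. indicator T t * \<phi> t) \<longrightarrow>
               E T u = calc (\<lambda>t. indicator T t * \<phi> t) x) \<and>
             (\<forall>z. integrable (\<mu> z) (\<lambda>t. (\<phi> t)\<^sup>2) \<longrightarrow> u \<bullet> z = form \<phi> x z)"
proof -
  define p where "p n t = indicator {t. \<bar>\<phi> t\<bar> \<le> real n} t * \<phi> t" for n :: nat and t
  have bb: "bounded_borel (p n)" for n
    unfolding p_def by (rule bounded_borel_truncation[OF \<phi>]) simp
  have p_tendsto: "(\<lambda>n. p n t) \<longlonglongrightarrow> \<phi> t" for t unfolding p_def by (rule truncation_tendsto)
  have p_le: "\<bar>p n t\<bar> \<le> \<bar>\<phi> t\<bar>" for n t by (simp add: p_def indicator_def)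
  define u where "u n = calc (p n) x" for n
  define a where "a n = (\<integral>t. (p n t)\<^sup>2 \<partial>\<mu> x)" for n
  have "a \<longlonglongrightarrow> (\<integral>t. (\<phi> t)\<^sup>2 \<partial>\<mu> x)"
    unfolding a_def
  proof (rule integral_dominated_convergence[OF _ _ int])
    show "AE t in \<mu> x. norm ((p n t)\<^sup>2) \<le> (\<phi> t)\<^sup>2" for n
      using p_le by (auto simp: abs_le_square_iff)
    show "AE t in \<mu> x. (\<lambda>n. (p n t)\<^sup>2) \<longlonglongrightarrow> (\<phi> t)\<^sup>2"
      by (intro AE_I2 tendsto_power p_tendsto)
    show "(\<lambda>t. (p n t)\<^sup>2) \<in> borel_measurable (\<mu> x)" for n
      using bounded_borel_measurable[OF bb[of n]] by simp
  qed (use \<phi> in simp)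
  then have Ca: "Cauchy a" by (rule LIMSEQ_imp_Cauchy)
  \<comment> \<open>Pointwise \<open>p n t\<close> is either 0 or \<open>p m t\<close>, so the
    square of the difference is the difference of the squares.\<close>
  have eq: "(norm (u m - u n))\<^sup>2 = a m - a n" if "n \<le> m" for m n
  proof -
    have "(norm (u m - u n))\<^sup>2 = (\<integral>t. (p m t - p n t)\<^sup>2 \<partial>\<mu> x)"
      unfolding u_def using bb by (simp add: calc_diff[symmetric] norm_calc_eq)
    also have "\<dots> = (\<integral>t. (p m t)\<^sup>2 - (p n t)\<^sup>2 \<partial>\<mu> x)"
      using that by (intro Bochner_Integration.integral_cong) (auto simp: p_def indicator_def)
    also have "\<dots> = a m - a n"
      unfolding a_def using bb by (intro Bochner_Integration.integral_diff integrable_\<mu>) auto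
    finally show ?thesis .
  qed
  have eq_abs: "(norm (u m - u n))\<^sup>2 \<le> \<bar>a m - a n\<bar>" for m n
  proof (cases "n \<le> m")
    case True
    then show ?thesis using eq by simp
  next
    case False
    then show ?thesis using eq[of m n] by (simp add: norm_minus_commute)
  qed
  have "Cauchy u"
  proof (rule CauchyI)
    fix e :: real assume "e > 0"
    then obtain N where N: "\<And>m n. m \<ge> N \<Longrightarrow> n \<ge> N \<Longrightarrow> norm (a m - a n) < e\<^sup>2"
      using CauchyD[OF Ca, of "e\<^sup>2"] by auto
    have "norm (u m - u n) < e" if "m \<ge> N" "n \<ge> N" for m n
    proof (rule power2_less_imp_less)
      show "(norm (u m - u n))\<^sup>2 < e\<^sup>2" using eq_abs[of m n] N[OF that] by simp
    qed (use \<open>e > 0\<close> in simp)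
    then show "\<exists>M. \<forall>m\<ge>M. \<forall>n\<ge>M. norm (u m - u n) < e" by blast
  qed
  then obtain v where v: "u \<longlonglongrightarrow> v" using Cauchy_convergent_iff convergent_def by blast
  have "E T v = calc (\<lambda>t. indicator T t * \<phi> t) x"
    if T: "T \<in> sets borel" and b: "bounded_borel (\<lambda>t. indicator T t * \<phi> t)" for T
  proof -
    obtain C where C: "\<And>t. \<bar>indicator T t * \<phi> t\<bar> \<le> C" using b by (auto simp: bounded_borel_def)
    \<comment> \<open>On \<open>T\<close> the function is bounded by \<open>C\<close>, so truncating
      at a level of at least \<open>C\<close> changes nothing there.\<close>
    have "E T (u n) = calc (\<lambda>t. indicator T t * \<phi> t) x" if "real n \<ge> C" for n
    proof -
      have "(\<lambda>t. indicator T t * p n t) = (\<lambda>t. indicator T t * \<phi> t)"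
      proof
        fix t
        show "indicator T t * p n t = indicator T t * \<phi> t"
          using C[of t] that by (auto simp: p_def indicator_def)
      qed
      then show ?thesis unfolding u_def E_calc[OF T bb] by simp
    qed
    moreover have "\<forall>\<^sub>F n in sequentially. real n \<ge> C"
      using filterlim_real_sequentially by (simp add: filterlim_at_top)
    ultimately have "\<forall>\<^sub>F n in sequentially. E T (u n) = calc (\<lambda>t. indicator T t * \<phi> t) x"
      by (auto elim: eventually_mono)
    then have "(\<lambda>n. E T (u n)) \<longlonglongrightarrow> calc (\<lambda>t. indicator T t * \<phi> t) x" by (rule tendsto_eventually)
    moreover have "(\<lambda>n. E T (u n)) \<longlonglongrightarrow> E T v"
      by (rule bounded_linear.tendsto[OF E_linear[OF T] v])
    ultimately show ?thesis using LIMSEQ_unique by blast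
  qed
  moreover have "v \<bullet> z = form \<phi> x z" if z: "integrable (\<mu> z) (\<lambda>t. (\<phi> t)\<^sup>2)" for z
  proof -
    have lim: "(\<lambda>n. integral\<^sup>L (\<mu> y) (p n)) \<longlonglongrightarrow> integral\<^sup>L (\<mu> y) \<phi>"
      if "integrable (\<mu> y) (\<lambda>t. (\<phi> t)\<^sup>2)" for y
    proof (rule integral_dominated_convergence)
      show "integrable (\<mu> y) (\<lambda>t. \<bar>\<phi> t\<bar>)" using integrable_of_square[OF \<phi> that] by simp
      show "AE t in \<mu> y. norm (p n t) \<le> \<bar>\<phi> t\<bar>" for n using p_le by auto
      show "AE t in \<mu> y. (\<lambda>n. p n t) \<longlonglongrightarrow> \<phi> t" using p_tendsto by auto
    qed (use \<phi> bounded_borel_measurable[OF bb] in simp_all)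
    have "(\<lambda>n. form (p n) x z) \<longlonglongrightarrow> form \<phi> x z"
      unfolding form_def
      by (rule tendsto_divide[OF tendsto_diff[OF lim lim] tendsto_const])
         (simp_all add: square_integrable_add[OF \<phi> int z])
    moreover have "(\<lambda>n. u n \<bullet> z) \<longlonglongrightarrow> v \<bullet> z" by (intro tendsto_intros v)
    ultimately show ?thesis unfolding u_def inner_calc[OF bb] using LIMSEQ_unique by blast
  qed
  ultimately show ?thesis by blast
qed

section \<open>The graph of a spectral integral\<close>

lemma spectral_integral_domain_iff:
  "x \<in> spectral_integral_domain E S \<phi> \<longleftrightarrow>
     (\<lambda>t. indicator S t * \<phi> t) \<in> borel_measurable borel \<and>
     integrable (\<mu> x) (\<lambda>t. (indicator S t * \<phi> t)\<^sup>2)"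
proof -
  have "(\<lambda>t. indicator S t * (\<phi> t)\<^sup>2) = (\<lambda>t. (indicator S t * \<phi> t)\<^sup>2)"
    by (auto simp: indicator_def)
  then show ?thesis
    by (simp add: spectral_integral_domain_def set_borel_measurable_def set_integrable_def)
qed

lemma spectral_integral_iff:
  "(x, y) \<in> spectral_integral E S \<phi> \<longleftrightarrow> x \<in> spectral_integral_domain E S \<phi> \<and>
     (\<forall>z\<in>spectral_integral_domain E S \<phi>. y \<bullet> z = form (\<lambda>t. indicator S t * \<phi> t) x z)"
  by (simp add: spectral_integral_def form_def set_lebesgue_integral_def)

text \<open>The truncations \<open>E (T n) z\<close> lie in the domain, the function being bounded
  on \<open>T n\<close>, and converge to \<open>z\<close>. Testing against them separates
  \<open>y\<close> from \<open>y'\<close>.\<close>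

lemma spectral_integral_unique:
  assumes "(x, y) \<in> spectral_integral E S \<phi>" "(x, y') \<in> spectral_integral E S \<phi>"
  shows "y = y'"
proof -
  define p where "p t = indicator S t * \<phi> t" for t
  have p: "p \<in> borel_measurable borel"
    using assms by (auto simp: p_def[abs_def] spectral_integral_iff spectral_integral_domain_iff)
  define T where "T n = {t. \<bar>p t\<bar> \<le> real n}" for n :: nat
  have T: "T n \<in> sets borel" for n unfolding T_def by (rule sublevel_borel[OF p])
  have "y \<bullet> z = y' \<bullet> z" for z
  proof -
    have "E (T n) z \<in> spectral_integral_domain E S \<phi>" for n
    proof -
      have "bounded_borel (\<lambda>t. (indicator (T n) t * p t)\<^sup>2)"
        unfolding T_def by (intro bounded_borel_power bounded_borel_truncation p) simp
      moreover have "(indicator (T n) t * p t)\<^sup>2 = indicator (T n) t * (p t)\<^sup>2" for t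
        by (simp add: indicator_def)
      ultimately have "integrable (\<mu> z) (\<lambda>t. indicator (T n) t * (p t)\<^sup>2)"
        using integrable_\<mu> by simp
      then show ?thesis
        using p T unfolding spectral_integral_domain_iff p_def[symmetric]
        by (simp add: integrable_\<mu>_E)
    qed
    then have "(y - y') \<bullet> E (T n) z = 0" for n
      using assms unfolding spectral_integral_iff by (simp add: inner_diff_left)
    moreover have "(\<lambda>n. (y - y') \<bullet> E (T n) z) \<longlonglongrightarrow> (y - y') \<bullet> z"
      by (intro tendsto_intros E_tendsto T) (simp only: T_def eventually_sublevel)
    ultimately show ?thesis by (simp add: LIMSEQ_const_iff inner_diff_left)
  qed
  then show ?thesis using vector_eq_rdot[of y y'] by blast
qed

lemma spectral_integral_exists:
  assumes "x \<in> spectral_integral_domain E S \<phi>"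
  shows "\<exists>y. (x, y) \<in> spectral_integral E S \<phi>"
proof -
  obtain u where "\<forall>z. integrable (\<mu> z) (\<lambda>t. (indicator S t * \<phi> t)\<^sup>2) \<longrightarrow>
      u \<bullet> z = form (\<lambda>t. indicator S t * \<phi> t) x z"
    using unbounded_calc_exists[of "\<lambda>t. indicator S t * \<phi> t" x] assms
    by (auto simp: spectral_integral_domain_iff)
  then have "(x, u) \<in> spectral_integral E S \<phi>"
    unfolding spectral_integral_iff using assms spectral_integral_domain_iff by blast
  then show ?thesis ..
qed

text \<open>Uniqueness identifies \<open>y\<close> with the limit of truncations. This is the
  passage from an unbounded operator to the bounded calculus, where products can be formed
  freely.\<close>

lemma E_spectral_integral:
  assumes xy: "(x, y) \<in> spectral_integral E S \<phi>"
    and T: "T \<in> sets borel" and b: "bounded_borel (\<lambda>t. indicator T t * (indicator S t * \<phi> t))"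
  shows "E T y = calc (\<lambda>t. indicator T t * (indicator S t * \<phi> t)) x"
proof -
  have dom: "x \<in> spectral_integral_domain E S \<phi>" using xy by (simp add: spectral_integral_iff)
  then obtain u where u: "E T u = calc (\<lambda>t. indicator T t * (indicator S t * \<phi> t)) x"
    "\<forall>z. integrable (\<mu> z) (\<lambda>t. (indicator S t * \<phi> t)\<^sup>2) \<longrightarrow>
      u \<bullet> z = form (\<lambda>t. indicator S t * \<phi> t) x z"
    using unbounded_calc_exists[of "\<lambda>t. indicator S t * \<phi> t" x] T b
    by (auto simp: spectral_integral_domain_iff)
  then have "(x, u) \<in> spectral_integral E S \<phi>"
    unfolding spectral_integral_iff using dom spectral_integral_domain_iff by blast
  then have "y = u" by (rule spectral_integral_unique[OF xy])
  then show ?thesis using u(1) by (simp only:)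
qed

end

section \<open>Spectral resolutions of the Gram operator\<close>

locale gram_resolution = pvm E
  for E :: "real set \<Rightarrow> 'a::{real_inner, complete_space} \<Rightarrow> 'a" +
  fixes A :: "'a \<Rightarrow> 'b::real_inner"
  assumes bounded_linear_A: "bounded_linear A"
    and inj_A: "inj A"
    and resolution: "spectral_resolution (adjoint A \<circ> A) E"
begin

abbreviation B :: "'a \<Rightarrow> 'a" where "B x \<equiv> adjoint A (A x)"

abbreviation S :: "real set" where "S \<equiv> spectral_interval A"

lemma A_eq_0: "A x = 0 \<Longrightarrow> x = 0"
  using inj_A linear_0[OF bounded_linear.linear[OF bounded_linear_A]] by (metis injD)

lemma adjoint_A_diff: "adjoint A (y - z) = adjoint A y - adjoint A z"
  by (rule vector_eq_rdot[THEN iffD1])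
     (simp add: adjoint_inner[OF bounded_linear_A, symmetric] inner_diff_left inner_diff_right
       inner_commute[of "adjoint A _"] inner_commute[of _ "A _"])

lemma inner_B: "x \<bullet> B x = (norm (A x))\<^sup>2"
  by (simp add: adjoint_inner[OF bounded_linear_A, symmetric] power2_norm_eq_inner)

lemma S_borel [simp, measurable]: "S \<in> sets borel"
  by (simp add: spectral_interval_def)

section \<open>Location of the spectral measure\<close>

lemma E_B:
  assumes "T \<in> sets borel" "bounded_borel (\<lambda>t. indicator T t * t)"
  shows "E T (B x) = calc (\<lambda>t. indicator T t * t) x"
proof -
  have "(x, B x) \<in> spectral_integral E UNIV (\<lambda>t. t)"
    using resolution by (simp add: spectral_resolution_def)
  from E_spectral_integral[OF this assms(1)] assms(2) show ?thesis by simp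
qed

lemma bounded_borel_ident:
  assumes "T \<in> sets borel" "bounded T" shows "bounded_borel (\<lambda>t. indicator T t * t)"
proof -
  obtain C where C: "\<And>t. t \<in> T \<Longrightarrow> \<bar>t\<bar> \<le> C" using assms(2) by (auto simp: bounded_iff)
  then have "\<bar>indicator T t * t\<bar> \<le> \<bar>C\<bar>" for t
    using order_trans[OF C abs_ge_self] by (simp add: indicator_def)
  then show ?thesis using assms(1) by (intro bounded_borelI) auto
qed

lemma norm_A_E:
  assumes T: "T \<in> sets borel" "bounded T"
  shows "(norm (A (E T x)))\<^sup>2 = (\<integral>t. indicator T t * t \<partial>\<mu> (E T x))"
proof -
  let ?z = "E T x"
  note bb = bounded_borel_ident[OF T]
  have "(norm (A ?z))\<^sup>2 = E T ?z \<bullet> B ?z" by (simp add: inner_B E_idem T)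
  also have "\<dots> = calc (\<lambda>t. indicator T t * t) ?z \<bullet> ?z"
    by (simp add: E_selfadjoint E_B T bb inner_commute)
  also have "\<dots> = (\<integral>t. indicator T t * t \<partial>\<mu> ?z)" by (simp add: inner_calc form_diag bb)
  finally show ?thesis .
qed

lemma integral_indicator_\<mu>_E:
  assumes T: "T \<in> sets borel"
  shows "(\<integral>t. c * indicator T t \<partial>\<mu> (E T x)) = c * (norm (E T x))\<^sup>2"
  using T by (simp add: measure_\<mu> E_idem power2_norm_eq_inner)

text \<open>A Rayleigh quotient argument: on the range of \<open>E T\<close> the form of
  \<open>B\<close> is at least \<open>c\<close> times the squared norm and at most
  \<open>(onorm A)\<^sup>2\<close> times it. The bound \<open>d\<close> keeps \<open>T\<close>
  bounded, so the identity on \<open>T\<close> falls under the bounded calculus.\<close>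

lemma E_eq_0_above:
  assumes T: "T \<in> sets borel" "T \<subseteq> {c..d}" and c: "(onorm A)\<^sup>2 < c"
  shows "E T x = 0"
proof -
  have bT: "bounded T" using T(2) bounded_closed_interval bounded_subset by blast
  note bb = bounded_borel_ident[OF T(1) bT]
  have "c * (norm (E T x))\<^sup>2 = (\<integral>t. c * indicator T t \<partial>\<mu> (E T x))"
    by (rule integral_indicator_\<mu>_E[OF T(1), symmetric])
  also have "\<dots> \<le> (\<integral>t. indicator T t * t \<partial>\<mu> (E T x))"
    using T(2) by (intro integral_mono integrable_\<mu>[OF bb]
      integrable_\<mu>[OF bounded_borel_mult[OF bounded_borel_const bounded_borel_indicator[OF T(1)]]])
      (auto simp: indicator_def)
  also have "\<dots> = (norm (A (E T x)))\<^sup>2" by (simp add: norm_A_E T(1) bT)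
  also have "\<dots> \<le> (onorm A * norm (E T x))\<^sup>2"
    by (intro power_mono onorm bounded_linear_A) auto
  finally have "(c - (onorm A)\<^sup>2) * (norm (E T x))\<^sup>2 \<le> 0"
    by (simp add: power_mult_distrib algebra_simps)
  then show ?thesis using c by (simp add: mult_le_0_iff)
qed

lemma E_eq_0_below:
  assumes T: "T \<in> sets borel" "T \<subseteq> {c..d}" and d: "d < 0"
  shows "E T x = 0"
proof -
  have bT: "bounded T" using T(2) bounded_closed_interval bounded_subset by blast
  note bb = bounded_borel_ident[OF T(1) bT]
  have "0 \<le> (norm (A (E T x)))\<^sup>2" by simp
  also have "\<dots> = (\<integral>t. indicator T t * t \<partial>\<mu> (E T x))" by (simp add: norm_A_E T(1) bT)
  also have "\<dots> \<le> (\<integral>t. d * indicator T t \<partial>\<mu> (E T x))"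
    using T(2) by (intro integral_mono integrable_\<mu>[OF bb]
      integrable_\<mu>[OF bounded_borel_mult[OF bounded_borel_const bounded_borel_indicator[OF T(1)]]])
      (auto simp: indicator_def)
  also have "\<dots> = d * (norm (E T x))\<^sup>2" by (rule integral_indicator_\<mu>_E[OF T(1)])
  finally show ?thesis using d by (simp add: zero_le_mult_iff)
qed

text \<open>The identity function vanishes on \<open>{0}\<close>, so \<open>A\<close> annihilates
  \<open>E {0} x\<close>, and injectivity applies.\<close>

lemma E_0_eq_0: "E {0} x = 0"
proof -
  have "(\<lambda>t. indicator {0} t * t) = (\<lambda>t. 0::real)" by (auto simp: indicator_def)
  then have "(norm (A (E {0} x)))\<^sup>2 = 0" by (subst norm_A_E) auto
  then show ?thesis using A_eq_0 by simp
qed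

lemma E_S: "E S x = x"
proof -
  have null: "T \<in> null_sets (\<mu> x)" if "T \<in> sets borel" "E T x = 0" for T
    using that by (auto simp: null_sets_def emeasure_\<mu>)
  \<comment> \<open>Countably many null pieces exhausting the complement of \<open>S\<close> except
    0. The margin \<open>1 / Suc n\<close> gives the strict gap required above and below, and
    \<open>real n\<close> gives boundedness.\<close>
  define L where "L n = {(onorm A)\<^sup>2 + 1 / Suc n .. real n} \<union> {- real n .. - (1 / Suc n)}" for n
  have "L n \<in> null_sets (\<mu> x)" for n
    unfolding L_def
    by (intro null_sets.Un null E_eq_0_above[OF _ order_refl] E_eq_0_below[OF _ order_refl]) auto
  then have "(\<Union>n. L n) \<union> {0} \<in> null_sets (\<mu> x)"
    by (intro null_sets.Un null_sets_UN null[of "{0}"] E_0_eq_0) auto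
  moreover have "- S \<subseteq> (\<Union>n. L n) \<union> {0}"
  proof
    fix t assume t: "t \<in> - S"
    obtain n1 :: nat where n1: "\<bar>t\<bar> < real n1" using reals_Archimedean2 by blast
    \<comment> \<open>One index must serve two ends: large enough that \<open>real n\<close> exceeds
      \<open>\<bar>t\<bar>\<close>, and with margin smaller than the distance of \<open>t\<close>
      from the spectral interval.\<close>
    have *: "\<exists>n\<ge>n1. 1 / real (Suc n) < e" if e: "e > 0" for e
    proof -
      obtain n2 :: nat where n2: "inverse (real (Suc n2)) < e" using reals_Archimedean[OF e] by blast
      have "1 / real (Suc (max n1 n2)) \<le> 1 / real (Suc n2)" by (intro divide_left_mono) auto
      with n2 show ?thesis by (intro exI[of _ "max n1 n2"]) (auto simp: inverse_eq_divide)
    qed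
    consider "t = 0" | "t < 0" | "t > (onorm A)\<^sup>2" using t by (force simp: spectral_interval_def)
    then show "t \<in> (\<Union>n. L n) \<union> {0}"
    proof cases
      case 2
      then obtain n where "n \<ge> n1" "1 / real (Suc n) < - t" using *[of "- t"] by auto
      then have "t \<in> L n" using n1 by (auto simp: L_def)
      then show ?thesis by blast
    next
      case 3
      then obtain n where "n \<ge> n1" "1 / real (Suc n) < t - (onorm A)\<^sup>2"
        using *[of "t - (onorm A)\<^sup>2"] by auto
      then have "t \<in> L n" using n1 by (auto simp: L_def)
      then show ?thesis by blast
    qed simp
  qed
  ultimately have "- S \<in> null_sets (\<mu> x)"
    using null_sets_subset[of "(\<Union>n. L n) \<union> {0}" "\<mu> x" "- S"] borel_comp[OF S_borel] by simp
  then have "E (- S) x = 0"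
    by (simp add: null_sets_def emeasure_\<mu> inner_E)
  moreover have "E S x + E (- S) x = x"
  proof -
    have "E S x + E (- S) x = calc (\<lambda>t. indicator S t + indicator (- S) t) x"
      by (simp add: calc_add calc_indicator)
    also have "(\<lambda>t. indicator S t + indicator (- S) t) = (\<lambda>t. 1::real)"
      by (auto simp: indicator_def)
    finally show ?thesis by (simp add: calc_one)
  qed
  ultimately show ?thesis by simp
qed

lemma bounded_S: "bounded S"
  unfolding spectral_interval_def using bounded_closed_interval[of 0 "(onorm A)\<^sup>2"] by (rule bounded_subset) auto

section \<open>Moments and tails of the spectral measure\<close>

definition ident_S :: "real \<Rightarrow> real" where "ident_S t = indicator S t * t"

lemma bounded_borel_ident_S [simp]: "bounded_borel ident_S"
  unfolding ident_S_def[abs_def] by (rule bounded_borel_ident[OF S_borel bounded_S])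

lemma calc_ident_S: "calc ident_S x = B x"
  using E_B[OF S_borel bounded_borel_ident[OF S_borel bounded_S], of x]
  by (simp add: E_S ident_S_def[abs_def])

lemma calc_power: "calc (\<lambda>t. indicator S t * t ^ n) x = (B ^^ n) x"
proof (induction n)
  case 0
  then show ?case by (simp add: calc_indicator E_S)
next
  case (Suc n)
  have "bounded_borel (\<lambda>t. indicator S t * ident_S t ^ n)" by simp
  moreover have "(\<lambda>t. indicator S t * ident_S t ^ n) = (\<lambda>t. indicator S t * t ^ n)"
    by (auto simp: ident_S_def indicator_def)
  ultimately have bb: "bounded_borel (\<lambda>t. indicator S t * t ^ n)" by simp
  have "(\<lambda>t. indicator S t * t ^ Suc n) = (\<lambda>t. ident_S t * (indicator S t * t ^ n))"
    by (auto simp: ident_S_def indicator_def)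
  then have "calc (\<lambda>t. indicator S t * t ^ Suc n) x = calc ident_S (calc (\<lambda>t. indicator S t * t ^ n) x)"
    by (simp only: calc_calc[OF bounded_borel_ident_S bb])
  then show ?case by (simp only: calc_ident_S Suc funpow.simps comp_def)
qed

lemma bounded_borel_continuous:
  assumes "continuous_on UNIV g" shows "bounded_borel (\<lambda>t. indicator S t * g t)"
proof -
  have "compact (g ` {0..(onorm A)\<^sup>2})"
    using assms by (intro compact_continuous_image) (auto intro: continuous_on_subset)
  then obtain C where C: "\<And>t. t \<in> {0..(onorm A)\<^sup>2} \<Longrightarrow> \<bar>g t\<bar> \<le> C"
    using compact_imp_bounded by (force simp: bounded_iff)
  have "\<bar>indicator S t * g t\<bar> \<le> \<bar>C\<bar>" for t
    using C[of t] by (auto simp: indicator_def spectral_interval_def)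
  moreover have "(\<lambda>t. indicator S t * g t) \<in> borel_measurable borel"
    using borel_measurable_continuous_onI[OF assms] by (intro borel_measurable_times) auto
  ultimately show ?thesis by (intro bounded_borelI)
qed

text \<open>The right-hand side involves \<open>B\<close> and \<open>x\<close> but not
  \<open>E\<close>, so integrals of polynomials agree for any two resolutions.\<close>

lemma integral_polynomial:
  "(\<integral>t. indicator S t * (\<Sum>i\<le>n. a i * t ^ i) \<partial>\<mu> x) = (\<Sum>i\<le>n. a i * ((B ^^ i) x \<bullet> x))"
proof -
  have bb: "bounded_borel (\<lambda>t. indicator S t * t ^ i)" for i
    by (intro bounded_borel_continuous continuous_intros)
  have "(\<integral>t. indicator S t * (\<Sum>i\<le>n. a i * t ^ i) \<partial>\<mu> x)
      = (\<integral>t. (\<Sum>i\<le>n. a i * (indicator S t * t ^ i)) \<partial>\<mu> x)"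
    by (simp add: sum_distrib_left mult.left_commute)
  also have "\<dots> = (\<Sum>i\<le>n. a i * (\<integral>t. indicator S t * t ^ i \<partial>\<mu> x))"
    using bb by (subst Bochner_Integration.integral_sum) (auto intro: integrable_\<mu>)
  also have "\<dots> = (\<Sum>i\<le>n. a i * ((B ^^ i) x \<bullet> x))"
    by (simp add: form_diag[OF bb, symmetric] inner_calc[OF bb, symmetric] calc_power)
  finally show ?thesis .
qed

text \<open>Continuous ramps increase to the indicator of the open half-line. Integrals of
  continuous functions over \<open>S\<close> thus determine the tails of the whole measure, since by
  \<open>E_S\<close> nothing lies outside \<open>S\<close>.\<close>

lemma measure_greaterThan_tendsto:
  fixes a :: real
  shows "(\<lambda>k. \<integral>t. indicator S t * max 0 (min 1 (real k * (t - a))) \<partial>\<mu> x) \<longlonglongrightarrow> measure (\<mu> x) {a<..}"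
proof -
  have lim: "(\<lambda>k. max 0 (min 1 (real k * (t - a)))) \<longlonglongrightarrow> indicator {a<..} t" for t
  proof (cases "t > a")
    case True
    have "\<forall>\<^sub>F k in sequentially. 1 / (t - a) \<le> real k"
      using filterlim_real_sequentially by (simp add: filterlim_at_top)
    then have "\<forall>\<^sub>F k in sequentially. max 0 (min 1 (real k * (t - a))) = indicator {a<..} t"
      by eventually_elim (use True in \<open>auto simp: field_simps max_def min_def\<close>)
    then show ?thesis by (rule tendsto_eventually)
  next
    case False
    then have "real k * (t - a) \<le> 0" for k by (simp add: mult_nonneg_nonpos)
    then have "max 0 (min 1 (real k * (t - a))) = 0" for k
      by (smt (verit))
    then show ?thesis using False by simp
  qed
  have bb: "bounded_borel (\<lambda>t. indicator S t * max 0 (min 1 (real k * (t - a))))" for k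
    by (intro bounded_borel_continuous continuous_intros)
  interpret finite_measure "\<mu> x" by (rule finite_measure_\<mu>)
  have "(\<lambda>k. \<integral>t. indicator S t * max 0 (min 1 (real k * (t - a))) \<partial>\<mu> x)
      \<longlonglongrightarrow> (\<integral>t. indicator S t * indicator {a<..} t \<partial>\<mu> x)"
  proof (rule integral_dominated_convergence[where w = "\<lambda>_. 1"])
    show "AE t in \<mu> x. (\<lambda>k. indicator S t * max 0 (min 1 (real k * (t - a))))
        \<longlonglongrightarrow> indicator S t * indicator {a<..} t"
      by (intro AE_I2 tendsto_mult lim tendsto_const)
    show "(\<lambda>t. indicator S t * max 0 (min 1 (real k * (t - a)))) \<in> borel_measurable (\<mu> x)" for k
      using bounded_borel_measurable[OF bb[of k]] by simp
    show "AE t in \<mu> x. norm (indicator S t * max 0 (min 1 (real k * (t - a)))) \<le> 1" for k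
      by (auto simp: indicator_def)
  qed auto
  also have "(\<integral>t. indicator S t * indicator {a<..} t \<partial>\<mu> x) = measure (\<mu> x) {a<..}"
    using integral_\<mu>_E[OF S_borel, of "indicator {a<..}" x] by (simp add: E_S)
  finally show ?thesis .
qed

end

text \<open>The moments determine the spectral measure, by Weierstrass.\<close>

lemma scalar_spectral_measure_unique:
  assumes "gram_resolution E A" "gram_resolution E' A"
  shows "scalar_spectral_measure E x = scalar_spectral_measure E' x"
proof -
  interpret E: gram_resolution E A by fact
  interpret E': gram_resolution E' A by fact
  let ?M = "(onorm A)\<^sup>2" and ?S = "spectral_interval A"
  have cont: "(\<integral>t. indicator ?S t * g t \<partial>E.\<mu> x) = (\<integral>t. indicator ?S t * g t \<partial>E'.\<mu> x)"
    if g: "continuous_on UNIV g" for g :: "real \<Rightarrow> real"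
  proof -
    \<comment> \<open>A polynomial uniformly within \<open>e\<close> of \<open>g\<close> has equal
      integrals for both resolutions; each replacement costs \<open>e\<close> times the total mass
      \<open>(norm x)\<^sup>2\<close>.\<close>
    have close: "\<bar>(\<integral>t. indicator ?S t * g t \<partial>E.\<mu> x) - (\<integral>t. indicator ?S t * g t \<partial>E'.\<mu> x)\<bar>
        \<le> e * (2 * (norm x)\<^sup>2)" if e: "e > 0" for e
    proof -
      obtain p where p: "real_polynomial_function p" "\<And>t. t \<in> {0..?M} \<Longrightarrow> \<bar>g t - p t\<bar> < e"
        by (rule Stone_Weierstrass_real_polynomial_function
            [OF compact_Icc continuous_on_subset[OF g subset_UNIV] e, of 0 ?M]) blast
      obtain a n where an: "p = (\<lambda>t. \<Sum>i\<le>n. a i * t ^ i)"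
        using p(1) real_polynomial_function_iff_sum by blast
      have eq: "(\<integral>t. indicator ?S t * p t \<partial>E.\<mu> x) = (\<integral>t. indicator ?S t * p t \<partial>E'.\<mu> x)"
        unfolding an E.integral_polynomial E'.integral_polynomial ..
      have cp: "continuous_on UNIV p" unfolding an by (intro continuous_intros)
      have le: "\<bar>indicator ?S t * g t - indicator ?S t * p t\<bar> \<le> e" for t
        using p(2)[of t] e by (auto simp: indicator_def spectral_interval_def)
      have 1: "\<bar>(\<integral>t. indicator ?S t * g t \<partial>scalar_spectral_measure F x)
          - (\<integral>t. indicator ?S t * p t \<partial>scalar_spectral_measure F x)\<bar> \<le> e * (norm x)\<^sup>2"
        if "gram_resolution F A" for F
      proof -
        interpret F: gram_resolution F A by fact
        note bb = F.bounded_borel_continuous[OF g] F.bounded_borel_continuous[OF cp]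
        have "(\<integral>t. indicator ?S t * g t \<partial>F.\<mu> x) - (\<integral>t. indicator ?S t * p t \<partial>F.\<mu> x)
            = (\<integral>t. indicator ?S t * g t - indicator ?S t * p t \<partial>F.\<mu> x)"
          using bb by (simp add: F.integrable_\<mu>)
        moreover have "\<dots> \<le> e * (norm x)\<^sup>2"
          using bb le by (intro F.integral_\<mu>_le bounded_borel_diff) (auto simp: abs_le_iff)
        moreover have "(\<integral>t. indicator ?S t * p t \<partial>F.\<mu> x) - (\<integral>t. indicator ?S t * g t \<partial>F.\<mu> x)
            = (\<integral>t. indicator ?S t * p t - indicator ?S t * g t \<partial>F.\<mu> x)"
          using bb by (simp add: F.integrable_\<mu>)
        moreover have "\<dots> \<le> e * (norm x)\<^sup>2"
          using bb le by (intro F.integral_\<mu>_le bounded_borel_diff) (auto simp: abs_le_iff)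
        ultimately show ?thesis by linarith
      qed
      show ?thesis using 1[OF assms(1)] 1[OF assms(2)] eq by (simp add: algebra_simps abs_le_iff)
    qed
    have "\<bar>(\<integral>t. indicator ?S t * g t \<partial>E.\<mu> x) - (\<integral>t. indicator ?S t * g t \<partial>E'.\<mu> x)\<bar> \<le> 0"
    proof (rule field_le_epsilon)
      fix e :: real assume e: "e > 0"
      let ?c = "2 * (norm x)\<^sup>2"
      \<comment> \<open>Adding 1 avoids division by zero when \<open>x = 0\<close>.\<close>
      have "?c + 1 > 0" by (simp add: add_nonneg_pos)
      then have "e / (?c + 1) * ?c \<le> e" "e / (?c + 1) > 0"
        using e by (auto simp: field_simps)
      with close[OF this(2)] show "\<bar>(\<integral>t. indicator ?S t * g t \<partial>E.\<mu> x) - (\<integral>t. indicator ?S t * g t \<partial>E'.\<mu> x)\<bar> \<le> 0 + e" by linarith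
    qed
    then show ?thesis by simp
  qed
  show ?thesis
  proof (rule measure_eqI_lessThan)
    fix a :: real
    have "continuous_on UNIV (\<lambda>t. max 0 (min 1 (real k * (t - a))))" for k
      by (intro continuous_intros)
    from cont[OF this] have "measure (E.\<mu> x) {a<..} = measure (E'.\<mu> x) {a<..}"
      using E.measure_greaterThan_tendsto[where a = a and x = x] E'.measure_greaterThan_tendsto[where a = a and x = x]
      by (simp add: LIMSEQ_unique)
    then show "emeasure (E.\<mu> x) {a<..} = emeasure (E'.\<mu> x) {a<..}"
      by (simp add: finite_measure.emeasure_eq_measure[OF E.finite_measure_\<mu>]
          finite_measure.emeasure_eq_measure[OF E'.finite_measure_\<mu>])
    show "emeasure (E.\<mu> x) {a<..} < \<infinity>"
      by (simp add: finite_measure.emeasure_eq_measure[OF E.finite_measure_\<mu>])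
  qed auto
qed

lemma spectral_integral_cong:
  assumes "gram_resolution E A" "gram_resolution E' A"
  shows "spectral_integral E T \<phi> = spectral_integral E' T \<phi>"
  using scalar_spectral_measure_unique[OF assms]
  by (simp add: spectral_integral_def spectral_integral_domain_def)

section \<open>The error of a regularised solution\<close>

context gram_resolution
begin

text \<open>
  Here \<open>k(B) A\<^sup>*\<close> is estimated through its adjoint \<open>A k(B)\<close>, which avoids a polar decomposition.
\<close>

lemma norm_calc_adjoint_le:
  assumes k: "bounded_borel k" "\<And>t. t \<notin> S \<Longrightarrow> k t = 0" "\<And>t. t \<in> S \<Longrightarrow> sqrt t * \<bar>k t\<bar> \<le> a"
    and a: "0 \<le> a"
  shows "norm (calc k (adjoint A y)) \<le> a * norm y"
proof -
  define v where "v = calc k (adjoint A y)"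
  have "(norm (A (calc k v)))\<^sup>2 = calc k v \<bullet> calc ident_S (calc k v)"
    by (simp add: inner_B calc_ident_S)
  also have "\<dots> = v \<bullet> calc (\<lambda>t. k t * (ident_S t * k t)) v"
    using k(1) by (simp add: calc_selfadjoint calc_calc)
  also have "\<dots> = (\<integral>t. k t * (ident_S t * k t) \<partial>\<mu> v)"
    using k(1) by (simp add: inner_commute[of v] inner_calc form_diag)
  also have "\<dots> \<le> a\<^sup>2 * (norm v)\<^sup>2"
  proof (rule integral_\<mu>_le)
    show "k t * (ident_S t * k t) \<le> a\<^sup>2" for t
    proof (cases "t \<in> S")
      case True
      then have "(sqrt t * \<bar>k t\<bar>)\<^sup>2 \<le> a\<^sup>2"
        using k(3) by (intro power_mono) (auto simp: spectral_interval_def)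
      then show ?thesis
        using True by (simp add: power_mult_distrib ident_S_def spectral_interval_def)
          (simp add: power2_eq_square mult_ac)
    qed (use k(2) in simp)
  qed (use k(1) in simp)
  finally have "(norm (A (calc k v)))\<^sup>2 \<le> (a * norm v)\<^sup>2"
    by (simp only: power_mult_distrib)
  then have "norm (A (calc k v)) \<le> a * norm v"
    by (rule power2_le_imp_le) (simp add: a)
  \<comment> \<open>Moving \<open>k\<close> and \<open>adjoint A\<close> to the other side lets the
    bound on \<open>A (calc k v)\<close> be used at \<open>v\<close> itself; a factor
    \<open>norm v\<close> is then cancelled.\<close>
  moreover have "(norm v)\<^sup>2 = A (calc k v) \<bullet> y"
    using k(1) by (simp add: adjoint_inner[OF bounded_linear_A] calc_selfadjoint power2_norm_eq_inner v_def)
  moreover have "A (calc k v) \<bullet> y \<le> norm (A (calc k v)) * norm y"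
    by (rule norm_cauchy_schwarz)
  ultimately have "norm v * norm v \<le> norm v * (a * norm y)"
    using mult_right_mono[of "norm (A (calc k v))" "a * norm v" "norm y"]
    by (simp add: power2_eq_square mult_ac)
  then show ?thesis
    using a by (cases "norm v = 0") (auto simp: v_def)
qed

text \<open>Formally \<open>f - u\<close> is the bias \<open>- (t * h t - 1) * \<psi> t\<close>, as
  a function of \<open>B\<close>, applied to \<open>w\<close>, plus \<open>h\<close> of
  \<open>B\<close> applied to \<open>adjoint A (A f - y)\<close>. The two kernel bounds estimate
  these terms.\<close>

lemma regularisation_error:
  assumes wf: "(w, f) \<in> spectral_integral E S \<psi>"
    and h: "(\<lambda>t. indicator S t * h t) \<in> borel_measurable borel"
    and a: "\<And>t. t \<in> S \<Longrightarrow> sqrt t * \<bar>h t\<bar> \<le> a" "0 \<le> a"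
    and b: "\<And>t. t \<in> S \<Longrightarrow> \<bar>t * h t - 1\<bar> * \<bar>\<psi> t\<bar> \<le> b" "0 \<le> b"
  obtains u where "(adjoint A y, u) \<in> spectral_integral E S h"
    "norm (f - u) \<le> b * norm w + a * norm (A f - y)"
proof -
  define \<eta> where "\<eta> t = indicator S t * h t" for t
  define p where "p t = indicator S t * \<psi> t" for t
  have \<eta>: "\<eta> \<in> borel_measurable borel" using h by (simp add: \<eta>_def[abs_def])
  have p: "p \<in> borel_measurable borel"
    using wf by (simp add: p_def[abs_def] spectral_integral_iff spectral_integral_domain_iff)
  have noise: "norm (calc (\<lambda>t. indicator T t * \<eta> t) (adjoint A z)) \<le> a * norm z"
    if "bounded_borel (\<lambda>t. indicator T t * \<eta> t)" for T z
    using that a by (intro norm_calc_adjoint_le) (auto simp: \<eta>_def indicator_def spectral_interval_def)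
  \<comment> \<open>The noise bound is uniform over truncations, so it also shows that
    \<open>u\<close> exists, although \<open>h\<close> may be unbounded near 0.\<close>
  have "integrable (\<mu> (adjoint A y)) (\<lambda>t. (\<eta> t)\<^sup>2)"
    by (rule square_integrableI[OF \<eta>, where C = "a * norm y"])
       (intro noise bounded_borel_truncation[OF \<eta>] of_nat_0_le_iff)
  then have "adjoint A y \<in> spectral_integral_domain E S h"
    using \<eta> by (simp add: spectral_integral_domain_iff \<eta>_def[abs_def])
  then obtain u where u: "(adjoint A y, u) \<in> spectral_integral E S h"
    using spectral_integral_exists by blast
  \<comment> \<open>On \<open>T n\<close> both functions are bounded, so all products below belong
    to the bounded calculus.\<close>
  define T where "T n = {t. \<bar>\<eta> t\<bar> \<le> real n} \<inter> {t. \<bar>p t\<bar> \<le> real n}" for n :: nat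
  have T: "T n \<in> sets borel" for n
    unfolding T_def by (intro sets.Int sublevel_borel \<eta> p)
  have bb: "bounded_borel (\<lambda>t. indicator (T n) t * \<eta> t)" "bounded_borel (\<lambda>t. indicator (T n) t * p t)" for n
    using T[of n] \<eta> p by (auto intro!: bounded_borelI[of _ "real n"] simp: T_def indicator_def)
  have "norm (E (T n) (f - u)) \<le> b * norm w + a * norm (A f - y)" for n
  proof -
    let ?\<eta> = "\<lambda>t. indicator (T n) t * \<eta> t" and ?p = "\<lambda>t. indicator (T n) t * p t"
    let ?q = "\<lambda>t. ?\<eta> t * ident_S t"
    note bb = bb[of n]
    have bq: "bounded_borel ?q" using bb by simp
    have Ef: "E (T n) f = calc ?p w"
      using E_spectral_integral[OF wf T] bb by (simp add: p_def)
    have Eu: "E (T n) u = calc ?\<eta> (adjoint A y)"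
      using E_spectral_integral[OF u T] bb by (simp add: \<eta>_def)
    have "calc ?\<eta> (B f) = calc ?q f"
      by (simp only: calc_ident_S[symmetric] calc_calc[OF bb(1) bounded_borel_ident_S])
    \<comment> \<open>\<open>?q\<close> vanishes off \<open>T n\<close>, so \<open>E (T n)\<close>
      can be inserted in front of \<open>f\<close>, where \<open>Ef\<close> replaces it by a bounded
      function of \<open>B\<close> at \<open>w\<close>.\<close>
    also have "?q = (\<lambda>t. indicator (T n) t * ?q t)" by (auto simp: indicator_def)
    also have "calc (\<lambda>t. indicator (T n) t * ?q t) f = calc ?q (E (T n) f)"
      by (rule calc_E[OF T bq, symmetric])
    also have "\<dots> = calc (\<lambda>t. ?q t * ?p t) w"
      unfolding Ef by (rule calc_calc[OF bq bb(2)])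
    finally have "calc ?\<eta> (adjoint A y) = calc (\<lambda>t. ?q t * ?p t) w - calc ?\<eta> (adjoint A (A f - y))"
      using calc_arg_diff[OF bb(1), of "B f" "adjoint A (A f - y)"] by (simp add: adjoint_A_diff)
    then have eq: "E (T n) (f - u) = calc (\<lambda>t. ?p t - ?q t * ?p t) w + calc ?\<eta> (adjoint A (A f - y))"
      unfolding E_diff[OF T] Ef Eu by (simp add: calc_diff[OF bb(2) bounded_borel_mult[OF bq bb(2)]])
    have "norm (calc (\<lambda>t. ?p t - ?q t * ?p t) w) \<le> b * norm w"
    proof (rule norm_calc_le)
      show "\<bar>?p t - ?q t * ?p t\<bar> \<le> b" for t
      proof (cases "t \<in> T n \<inter> S")
        case True
        then have "?p t - ?q t * ?p t = - ((t * h t - 1) * \<psi> t)"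
          by (simp add: p_def \<eta>_def ident_S_def algebra_simps)
        then show ?thesis using b(1)[of t] True by (simp add: abs_mult)
      qed (use b(2) in \<open>auto simp: p_def indicator_def\<close>)
    qed (use b bb in simp_all)
    then show ?thesis
      unfolding eq using noise[OF bb(1), of "A f - y"] by (rule norm_triangle_mono)
  qed
  moreover have "\<forall>\<^sub>F n in sequentially. t \<in> T n" for t
    using eventually_conj[OF eventually_sublevel[of t \<eta>] eventually_sublevel[of t p]]
    by (simp add: T_def)
  then have "(\<lambda>n. norm (E (T n) (f - u))) \<longlonglongrightarrow> norm (f - u)"
    by (intro tendsto_norm E_tendsto T)
  ultimately have "norm (f - u) \<le> b * norm w + a * norm (A f - y)"
    by (intro LIMSEQ_le_const2) auto
  with u show thesis by (rule that)
qed

end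

section \<open>Independence of the resolution, and measurability of the filter functions\<close>

lemma gram_resolutionI:
  "bounded_linear A \<Longrightarrow> inj A \<Longrightarrow> spectral_resolution (adjoint A \<circ> A) E \<Longrightarrow> gram_resolution E A"
  by (intro gram_resolution.intro gram_resolution_axioms.intro pvm.intro)
     (auto simp: spectral_resolution_def)

lemma apply_operator_function_eqI:
  assumes "gram_resolution E A" "(x, y) \<in> spectral_integral E S \<phi>"
  shows "apply_operator_function S \<phi> (adjoint A \<circ> A) x = y"
proof -
  interpret gram_resolution E A by fact
  show ?thesis
    unfolding apply_operator_function_def operator_function_def
  proof (rule the_equality)
    fix z assume "(x, z) \<in> {(x, y). \<exists>E. spectral_resolution (adjoint A \<circ> A) E \<and> (x, y) \<in> spectral_integral E S \<phi>}"
    then obtain E' where "spectral_resolution (adjoint A \<circ> A) E'" "(x, z) \<in> spectral_integral E' S \<phi>"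
      by auto
    then have "(x, z) \<in> spectral_integral E S \<phi>"
      using spectral_integral_cong[OF gram_resolutionI[OF bounded_linear_A inj_A] assms(1)] by blast
    then show "z = y" by (rule spectral_integral_unique[OF _ assms(2)])
  qed (use resolution assms(2) in auto)
qed

text \<open>Breakpoints may accumulate at 0, so the interval is exhausted by
  \<open>{1 / Suc n..M}\<close>. On each of these, removing finitely many points leaves a continuous
  function, and restoring them preserves measurability.\<close>

lemma piecewise_continuous_on_borel_measurable:
  assumes "piecewise_continuous_on {0<..M} \<phi>"
  shows "(\<lambda>t. indicator {0<..M} t * \<phi> t) \<in> borel_measurable borel"
proof (rule borel_measurable_LIMSEQ_real)
  show "(\<lambda>t. indicator {1 / Suc n..M} t * \<phi> t) \<in> borel_measurable borel" for n :: nat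
  proof -
    have "0 < 1 / real (Suc n)" by simp
    then have "{1 / Suc n..M} \<subseteq> {0<..M}" by (meson atLeastAtMost_iff greaterThanAtMost_iff less_le_trans subsetI)
    then obtain T where T: "finite T" "continuous_on ({1 / Suc n..M} - T) \<phi>"
      using assms unfolding piecewise_continuous_on_def by blast
    have "{1 / Suc n..M} - T \<in> sets borel" using T(1) by (intro sets.Diff) (auto simp: finite_imp_closed)
    from borel_measurable_continuous_on_indicator[OF this T(2)]
    show ?thesis
      by (rule measurable_discrete_difference[where X = T])
         (use T(1) in \<open>auto simp: countable_finite indicator_def\<close>)
  qed
  show "(\<lambda>n. indicator {1 / Suc n..M} t * \<phi> t) \<longlonglongrightarrow> indicator {0<..M} t * \<phi> t" for t
  proof (rule tendsto_eventually)
    show "\<forall>\<^sub>F n in sequentially. indicator {1 / Suc n..M} t * \<phi> t = indicator {0<..M} t * \<phi> t"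
    proof (cases "t > 0")
      case True
      have "\<forall>\<^sub>F n in sequentially. 1 / real (Suc n) < t"
        using order_tendstoD(2)[OF LIMSEQ_Suc[OF lim_1_over_n] True] .
      then show ?thesis by eventually_elim (use True in \<open>auto simp: indicator_def\<close>)
    next
      case False
      then have "\<not> 1 / real (Suc n) \<le> t" for n
        using divide_pos_pos[of 1 "real (Suc n)"] by linarith
      then show ?thesis using False by (simp add: indicator_def)
    qed
  qed
qed

section \<open>Index functions and the parameter choice\<close>

locale concave_index_function =
  fixes \<Psi> :: "real \<Rightarrow> real"
  assumes index: "index_function \<Psi>" and concave: "concave_on {0<..} \<Psi>"
    and strict_mono: "strict_mono_on {0<..} \<Psi>"
    and lim_0: "(\<Psi> \<longlongrightarrow> 0) (at_right 0)" and lim_top: "filterlim \<Psi> at_top at_top"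
begin

abbreviation I :: "real \<Rightarrow> real" where "I \<equiv> inv_into {0<..} \<Psi>"

lemma \<Psi>_pos: "x > 0 \<Longrightarrow> \<Psi> x > 0"
  using index by (simp add: index_function_def)

lemma \<Psi>_surj:
  assumes "y > 0" shows "\<exists>x>0. \<Psi> x = y"
proof -
  have "\<forall>\<^sub>F x in at_right 0. \<Psi> x < y \<and> x > 0"
    using order_tendstoD(2)[OF lim_0 assms] eventually_at_right_less by (rule eventually_conj)
  then obtain x1 where x1: "x1 > 0" "\<Psi> x1 < y"
    using eventually_happens[of _ "at_right (0::real)"] by auto
  have "\<forall>\<^sub>F x in at_top. y \<le> \<Psi> x \<and> x1 \<le> x"
    using lim_top by (intro eventually_conj eventually_ge_at_top) (simp add: filterlim_at_top)
  then obtain x2 where x2: "y \<le> \<Psi> x2" "x1 \<le> x2"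
    using eventually_happens[of _ "at_top :: real filter"] by auto
  have "continuous_on {x1..x2} \<Psi>"
    using index x1(1) by (auto simp: index_function_def intro: continuous_on_subset)
  then obtain x where "x1 \<le> x" "\<Psi> x = y"
    using IVT'[of \<Psi> x1 y x2] x1 x2 by auto
  then show ?thesis using x1 by (intro exI[of _ x]) auto
qed

lemma I_pos: "y > 0 \<Longrightarrow> I y > 0" and \<Psi>_I: "y > 0 \<Longrightarrow> \<Psi> (I y) = y"
  using \<Psi>_surj[of y] inv_into_into[of y \<Psi> "{0<..}"] f_inv_into_f[of y \<Psi> "{0<..}"]
  by (auto simp: image_iff)

lemma I_\<Psi>: "x > 0 \<Longrightarrow> I (\<Psi> x) = x"
  using strict_mono by (intro inv_into_f_f strict_mono_on_imp_inj_on) auto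

lemma I_strict_mono:
  assumes "0 < y" "y < z" shows "I y < I z"
proof (rule ccontr)
  assume "\<not> I y < I z"
  then have "\<Psi> (I z) \<le> \<Psi> (I y)"
    using assms I_pos strict_mono by (intro strict_mono_on_leD[OF strict_mono]) auto
  then show False using assms \<Psi>_I by simp
qed

lemma psi_bar_eq: "t > 0 \<Longrightarrow> psi_bar \<Psi> t = 1 / sqrt (I (1 / t) * t)"
  by (simp add: psi_bar_def chi_def)

lemma psi_bar_pos: "t > 0 \<Longrightarrow> psi_bar \<Psi> t > 0"
  using I_pos[of "1 / t"] by (simp add: psi_bar_eq)

lemma Theta_eq: "t > 0 \<Longrightarrow> Theta \<Psi> t = 1 / sqrt (I (1 / t))"
  by (simp add: Theta_def psi_bar_eq real_sqrt_mult)

lemma Theta_strict_mono: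
  assumes "0 < s" "s < t" shows "Theta \<Psi> s < Theta \<Psi> t"
proof -
  have "I (1 / t) < I (1 / s)" using assms by (intro I_strict_mono) (auto simp: field_simps)
  then show ?thesis
    using assms I_pos[of "1 / t"] by (simp add: Theta_eq divide_strict_left_mono)
qed

lemma Theta_inv_eq:
  assumes "\<delta> > 0" shows "Theta_inv \<Psi> \<delta> = 1 / \<Psi> (1 / \<delta>\<^sup>2)"
  unfolding Theta_inv_def
proof (rule inv_into_f_eq)
  show "inj_on (Theta \<Psi>) {0<..}"
    by (intro linorder_inj_onI) (auto dest: Theta_strict_mono)
  show "1 / \<Psi> (1 / \<delta>\<^sup>2) \<in> {0<..}" using assms \<Psi>_pos by simp
  have "Theta \<Psi> (1 / \<Psi> (1 / \<delta>\<^sup>2)) = 1 / sqrt (1 / \<delta>\<^sup>2)"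
    using assms \<Psi>_pos[of "1 / \<delta>\<^sup>2"] I_\<Psi>[of "1 / \<delta>\<^sup>2"] by (simp add: Theta_eq)
  then show "Theta \<Psi> (1 / \<Psi> (1 / \<delta>\<^sup>2)) = \<delta>"
    using assms by (simp add: real_sqrt_divide)
qed

lemma Theta_inv_pos: "\<delta> > 0 \<Longrightarrow> Theta_inv \<Psi> \<delta> > 0"
  using \<Psi>_pos[of "1 / \<delta>\<^sup>2"] by (simp add: Theta_inv_eq)

lemma filterlim_Theta_inv: "filterlim (Theta_inv \<Psi>) (at_right 0) (at_right 0)"
proof -
  have "filterlim (\<lambda>\<delta>::real. inverse (\<delta>\<^sup>2)) at_top (at_right 0)"
    by (intro filterlim_compose[OF filterlim_inverse_at_top_right])
       (auto simp: filterlim_at eventually_at_filter intro!: tendsto_eq_intros)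
  then have "filterlim (\<lambda>\<delta>. \<Psi> (1 / \<delta>\<^sup>2)) at_top (at_right 0)"
    using filterlim_compose[OF lim_top] by (simp add: inverse_eq_divide)
  then have "filterlim (\<lambda>\<delta>. inverse (\<Psi> (1 / \<delta>\<^sup>2))) (at_right 0) (at_right 0)"
    by (rule filterlim_compose[OF filterlim_inverse_at_right_top])
  then show ?thesis
  proof (rule filterlim_cong[THEN iffD1, OF refl refl, rotated])
    show "\<forall>\<^sub>F \<delta> in at_right 0. inverse (\<Psi> (1 / \<delta>\<^sup>2)) = Theta_inv \<Psi> \<delta>"
      using eventually_at_right_less[of 0] by eventually_elim (simp add: Theta_inv_eq inverse_eq_divide)
  qed
qed

text \<open>The graph lies above the chord from \<open>x\<close> to \<open>r\<close> at
  \<open>s\<close>; positivity of \<open>\<Psi> x\<close> lets the left endpoint term be dropped.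
  Since 0 is outside the domain, \<open>x\<close> is only taken close to 0.\<close>

lemma \<Psi>_over_ident_antimono:
  assumes "0 < s" "s \<le> r" shows "s * \<Psi> r \<le> r * \<Psi> s"
proof (rule field_le_epsilon)
  fix e :: real assume e: "e > 0"
  have r: "r > 0" "\<Psi> r > 0" using assms \<Psi>_pos by auto
  \<comment> \<open>\<open>s / 2\<close> keeps \<open>x\<close> below \<open>s\<close>, and
    \<open>e / \<Psi> r\<close> makes the error \<open>x * \<Psi> r\<close> at most
    \<open>e\<close>.\<close>
  define x where "x = min (s / 2) (e / \<Psi> r)"
  have x: "0 < x" "x < s" "x * \<Psi> r \<le> e"
    using e r assms by (auto simp: x_def min_def field_simps)
  define \<theta> where "\<theta> = (s - x) / (r - x)"
  have \<theta>: "0 \<le> \<theta>" "\<theta> \<le> 1" using x assms by (auto simp: \<theta>_def field_simps)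
  have "(1 - \<theta>) *\<^sub>R x + \<theta> *\<^sub>R r = x + \<theta> * (r - x)" by (simp add: algebra_simps)
  also have "\<dots> = s" using x assms by (simp add: \<theta>_def)
  finally have "\<Psi> s \<ge> (1 - \<theta>) * \<Psi> x + \<theta> * \<Psi> r"
    using concave_onD[OF concave \<theta>, of x r] x r by simp
  then have "\<theta> * \<Psi> r \<le> \<Psi> s" using \<theta> \<Psi>_pos[OF x(1)] by (smt (verit) mult_nonneg_nonneg)
  then have "(s - x) * \<Psi> r \<le> (r - x) * \<Psi> s"
    using x assms by (simp add: \<theta>_def field_simps)
  moreover have "x * \<Psi> s \<ge> 0" using x assms \<Psi>_pos[of s] by simp
  ultimately show "s * \<Psi> r \<le> r * \<Psi> s + e" using x(3) by (simp add: algebra_simps)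
qed

text \<open>With \<open>x = I (1 / t)\<close> one has \<open>I (1 / t) * t = x / \<Psi> x\<close>,
  and \<open>x\<close> decreases as \<open>t\<close> grows.\<close>

lemma psi_bar_mono:
  assumes "0 < s" "s \<le> t" shows "psi_bar \<Psi> s \<le> psi_bar \<Psi> t"
proof -
  have pos: "1 / s > 0" "1 / t > 0" using assms by auto
  have "I (1 / t) \<le> I (1 / s)"
    using assms I_strict_mono[of "1 / t" "1 / s"] by (cases "s = t") (auto simp: field_simps)
  from \<Psi>_over_ident_antimono[OF I_pos[OF pos(2)] this] have "I (1 / t) * t \<le> I (1 / s) * s"
    using assms by (simp add: \<Psi>_I pos field_simps)
  moreover have "I (1 / t) * t > 0" using I_pos[OF pos(2)] assms by simp
  ultimately show ?thesis
    using assms by (simp add: psi_bar_eq frac_le)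
qed

section \<open>Kernel bounds at the chosen parameter\<close>

context
  fixes \<delta> :: real
  assumes \<delta>: "\<delta> > 0"
begin

abbreviation \<alpha> :: real where "\<alpha> \<equiv> Theta_inv \<Psi> \<delta>"

lemma inverse_sqrt_Theta_inv: "1 / sqrt \<alpha> = sqrt (\<Psi> (1 / \<delta>\<^sup>2))"
  using \<delta> by (simp add: Theta_inv_eq real_sqrt_divide)

lemma psi_bar_Theta_inv: "psi_bar \<Psi> \<alpha> = \<delta> * sqrt (\<Psi> (1 / \<delta>\<^sup>2))"
proof -
  have "I (1 / \<alpha>) * \<alpha> = (1 / \<delta>\<^sup>2) * \<alpha>" using \<delta> I_\<Psi>[of "1 / \<delta>\<^sup>2"] by (simp add: Theta_inv_eq)
  then have "psi_bar \<Psi> \<alpha> = \<delta> * (1 / sqrt \<alpha>)"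
    using \<delta> Theta_inv_pos[OF \<delta>] by (simp add: psi_bar_eq real_sqrt_mult real_sqrt_divide)
  then show ?thesis by (simp only: inverse_sqrt_Theta_inv)
qed

lemma Theta_Theta_inv: "Theta \<Psi> \<alpha> = sqrt \<alpha> * psi_bar \<Psi> \<alpha>"
  by (simp add: Theta_def)

text \<open>Here \<open>k\<close> is a value of the filter at \<open>t\<close> and \<open>G\<close>
  a value of \<open>\<Gamma>\<close>. For \<open>t \<le> \<alpha>\<close>, the factor
  \<open>\<delta>\<close> in \<open>psi_bar \<Psi> \<alpha>\<close> is absorbed by
  \<open>\<delta> * G \<le> C\<close>. For \<open>t > \<alpha>\<close>, dividing
  \<open>t * \<bar>k\<bar> \<le> C1\<close> by \<open>sqrt t\<close> costs at most
  \<open>1 / sqrt \<alpha>\<close>.\<close>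

lemma noise_kernel_le:
  assumes t: "t > 0" and C1: "t * \<bar>k\<bar> \<le> C1"
    and G: "sqrt t * \<bar>k\<bar> / psi_bar \<Psi> t \<le> G" "\<delta> * G \<le> C"
  shows "sqrt t * \<bar>k\<bar> \<le> max C1 C * sqrt (\<Psi> (1 / \<delta>\<^sup>2))"
proof (cases "t \<le> \<alpha>")
  case True
  have "0 \<le> sqrt t * \<bar>k\<bar> / psi_bar \<Psi> t" using t psi_bar_pos[OF t] by simp
  with G(1) have "G \<ge> 0" by linarith
  have "sqrt t * \<bar>k\<bar> \<le> G * psi_bar \<Psi> t" using G(1) psi_bar_pos[OF t] by (simp add: field_simps)
  also have "\<dots> \<le> G * psi_bar \<Psi> \<alpha>"
    using psi_bar_mono[OF t True] \<open>G \<ge> 0\<close> by (rule mult_left_mono)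
  also have "\<dots> = (\<delta> * G) * sqrt (\<Psi> (1 / \<delta>\<^sup>2))" by (simp add: psi_bar_Theta_inv)
  also have "\<dots> \<le> max C1 C * sqrt (\<Psi> (1 / \<delta>\<^sup>2))"
    using G(2) \<delta> \<Psi>_pos[of "1 / \<delta>\<^sup>2"] by (intro mult_right_mono) auto
  finally show ?thesis .
next
  case False
  have "0 \<le> C1" by (rule order_trans[OF _ C1]) (use t in simp)
  have "sqrt t * sqrt t = t" using t by simp
  then have "sqrt t * \<bar>k\<bar> = t * \<bar>k\<bar> * (1 / sqrt t)" using t by (simp add: field_simps)
  also have "\<dots> \<le> max C1 C * (1 / sqrt \<alpha>)"
    using False C1 t Theta_inv_pos[OF \<delta>] \<open>0 \<le> C1\<close> by (intro mult_mono divide_left_mono) auto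
  finally show ?thesis by (simp only: inverse_sqrt_Theta_inv)
qed

text \<open>For \<open>t \<le> \<alpha>\<close> the residual is at most \<open>C1 + 1\<close> and
  \<open>psi_bar\<close> is monotone. For \<open>t > \<alpha>\<close> the qualification carries
  \<open>sqrt t\<close> on the left and the smaller \<open>sqrt \<alpha>\<close> on the right, so
  \<open>sqrt t\<close> cancels.\<close>

lemma bias_kernel_le:
  assumes t: "t > 0" and C1: "t * \<bar>k\<bar> \<le> C1"
    and C: "\<bar>t * k - 1\<bar> * Theta \<Psi> t \<le> C * Theta \<Psi> \<alpha>" "C \<ge> 0"
  shows "\<bar>t * k - 1\<bar> * \<bar>psi_bar \<Psi> t\<bar> \<le> max (C1 + 1) C * (\<delta> * sqrt (\<Psi> (1 / \<delta>\<^sup>2)))"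
proof (cases "t \<le> \<alpha>")
  case True
  have "\<bar>t * k - 1\<bar> \<le> C1 + 1" using C1 t abs_triangle_ineq4[of "t * k" 1] by (simp add: abs_mult)
  then have "\<bar>t * k - 1\<bar> * \<bar>psi_bar \<Psi> t\<bar> \<le> max (C1 + 1) C * psi_bar \<Psi> \<alpha>"
    using psi_bar_mono[OF t True] psi_bar_pos[OF t] C(2) by (intro mult_mono) auto
  then show ?thesis by (simp only: psi_bar_Theta_inv)
next
  case False
  have \<alpha>: "\<alpha> > 0" by (rule Theta_inv_pos[OF \<delta>])
  have "sqrt t * (\<bar>t * k - 1\<bar> * psi_bar \<Psi> t) = \<bar>t * k - 1\<bar> * Theta \<Psi> t"
    by (simp add: Theta_def)
  also have "\<dots> \<le> sqrt \<alpha> * (C * psi_bar \<Psi> \<alpha>)" using C(1) by (simp add: Theta_Theta_inv mult_ac)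
  also have "\<dots> \<le> sqrt t * (max (C1 + 1) C * psi_bar \<Psi> \<alpha>)"
    using False C(2) psi_bar_pos[OF \<alpha>] \<alpha> by (intro mult_mono) auto
  finally show ?thesis
    using t psi_bar_pos[OF t] by (simp only: psi_bar_Theta_inv) simp
qed

end

end

theorem proposition4p1:
  fixes A :: "'a::{real_inner, polish_space} \<Rightarrow> 'b::{real_inner, polish_space}"
    and \<Psi> :: "real \<Rightarrow> real"
    and h :: "real \<Rightarrow> real \<Rightarrow> real"
    and \<Gamma> :: "real \<Rightarrow> real"
    and \<alpha>max :: ereal
    and \<delta>max C1 Cpara Cquali :: real
    and f :: 'a and g :: 'b and gd :: "real \<Rightarrow> 'b"
  assumes "infinite_dimensional (UNIV :: 'a set)" "infinite_dimensional (UNIV :: 'b set)"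
    and "bounded_linear A" "inj A" "\<not> closed (range A)"
    and "index_function \<Psi>" "concave_on {0<..} \<Psi>" "strict_mono_on {0<..} \<Psi>"
    and "(\<Psi> \<longlongrightarrow> 0) (at_right 0)"
    and "filterlim \<Psi> at_top at_top"
    and "((\<lambda>x. \<Psi> x / x) \<longlongrightarrow> 0) at_top"
    and "A f = g"
    and "f \<in> Range (operator_function (spectral_interval A) (psi_bar \<Psi>) (adjoint A \<circ> A))"
    and "\<alpha>max > 0" "\<delta>max > 0" "C1 > 0" "Cpara > 0" "Cquali > 0"
    and "\<And>\<delta>. 0 < \<delta> \<Longrightarrow> \<delta> \<le> \<delta>max \<Longrightarrow> norm (g - gd \<delta>) \<le> \<delta>"
    and "\<And>\<alpha>. 0 < \<alpha> \<Longrightarrow> ereal \<alpha> \<le> \<alpha>max \<Longrightarrow> piecewise_continuous_on (spectral_interval A) (h \<alpha>)"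
    and "\<And>t. t \<in> spectral_interval A \<Longrightarrow> ((\<lambda>\<alpha>. t * h \<alpha> t - 1) \<longlongrightarrow> 0) (at_right 0)"
    and "\<And>\<alpha> t. 0 < \<alpha> \<Longrightarrow> ereal \<alpha> \<le> \<alpha>max \<Longrightarrow> t \<in> spectral_interval A \<Longrightarrow> t * \<bar>h \<alpha> t\<bar> \<le> C1"
    and "\<forall>\<^sub>F \<alpha> in at_right 0. \<forall>t \<in> spectral_interval A. sqrt t * \<bar>h \<alpha> t\<bar> / psi_bar \<Psi> t \<le> \<Gamma> \<alpha>"
    and "\<And>\<delta>. 0 < \<delta> \<Longrightarrow> \<delta> \<le> \<delta>max \<Longrightarrow> \<delta> * \<Gamma> (Theta_inv \<Psi> \<delta>) \<le> Cpara"
    and "\<And>\<alpha> t. 0 < \<alpha> \<Longrightarrow> ereal \<alpha> \<le> \<alpha>max \<Longrightarrow> t \<in> spectral_interval A \<Longrightarrow>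
           \<bar>t * h \<alpha> t - 1\<bar> * Theta \<Psi> t \<le> Cquali * Theta \<Psi> \<alpha>"
  shows "filterlim (Theta_inv \<Psi>) (at_right 0) (at_right 0) \<and>
    (\<exists>K>0. (\<lambda>\<delta>. norm (f - regularised_solution A h (gd \<delta>) (Theta_inv \<Psi> \<delta>)))
             \<in> O[at_right 0](\<lambda>\<delta>. \<delta> * sqrt (\<Psi> (K / \<delta>\<^sup>2))))"
proof -
  note [simp] = spectral_interval_def
  interpret concave_index_function \<Psi> by unfold_locales fact+
  let ?S = "spectral_interval A" and ?\<alpha> = "Theta_inv \<Psi>"
  obtain w E where E: "spectral_resolution (adjoint A \<circ> A) E"
    and wf: "(w, f) \<in> spectral_integral E ?S (psi_bar \<Psi>)"
    using assms(13) by (auto simp: operator_function_def)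
  have gr: "gram_resolution E A" by (rule gram_resolutionI) fact+
  interpret gram_resolution E A by fact
  define c1 where "c1 = max C1 Cpara"
  define c2 where "c2 = max (C1 + 1) Cquali"
  define R where "R \<delta> = \<delta> * sqrt (\<Psi> (1 / \<delta>\<^sup>2))" for \<delta>
  have small_\<alpha>: "\<forall>\<^sub>F \<alpha> in at_right 0. ereal \<alpha> \<le> \<alpha>max"
  proof (cases \<alpha>max)
    case (real r)
    then have "\<forall>\<^sub>F \<alpha> in at_right 0. \<alpha> < r"
      using \<open>\<alpha>max > 0\<close> by (intro order_tendstoD(2)[OF tendsto_ident_at]) simp
    then show ?thesis by eventually_elim (simp add: real)
  qed (use \<open>\<alpha>max > 0\<close> in auto)
  have "\<forall>\<^sub>F \<delta> in at_right 0. \<delta> < \<delta>max"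
    using \<open>\<delta>max > 0\<close> by (intro order_tendstoD(2)[OF tendsto_ident_at])
  \<comment> \<open>The bound through \<open>\<Gamma>\<close> and the range of
    \<open>\<alpha>\<close> hold for small \<open>\<alpha>\<close>; they are pulled back to small
    \<open>\<delta>\<close> along the limit of \<open>Theta_inv\<close>.\<close>
  then have bound: "\<forall>\<^sub>F \<delta> in at_right 0.
      norm (f - regularised_solution A h (gd \<delta>) (?\<alpha> \<delta>)) \<le> (c2 * norm w + c1) * R \<delta>"
    using eventually_at_right_less
      eventually_compose_filterlim[OF small_\<alpha> filterlim_Theta_inv]
      eventually_compose_filterlim[OF assms(23) filterlim_Theta_inv]
  proof eventually_elim
    case (elim \<delta>)
    then have \<delta>: "\<delta> > 0" "\<delta> \<le> \<delta>max" and \<alpha>: "?\<alpha> \<delta> > 0" "ereal (?\<alpha> \<delta>) \<le> \<alpha>max"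
      by (simp_all add: Theta_inv_pos)
    have R: "0 \<le> R \<delta>" "0 \<le> sqrt (\<Psi> (1 / \<delta>\<^sup>2))"
      using \<delta>(1) \<Psi>_pos[of "1 / \<delta>\<^sup>2"] by (simp_all add: R_def)
    have c: "0 \<le> c1" "0 \<le> c2" using \<open>C1 > 0\<close> \<open>Cquali > 0\<close> by (auto simp: c1_def c2_def)
    have meas: "(\<lambda>t. indicator ?S t * h (?\<alpha> \<delta>) t) \<in> borel_measurable borel"
      using assms(20)[OF \<alpha>] piecewise_continuous_on_borel_measurable by simp
    have noise: "sqrt t * \<bar>h (?\<alpha> \<delta>) t\<bar> \<le> c1 * sqrt (\<Psi> (1 / \<delta>\<^sup>2))" if "t \<in> ?S" for t
      unfolding c1_def
      using that elim(4) assms(22)[OF \<alpha> that] assms(24)[OF \<delta>]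
      by (intro noise_kernel_le[OF \<delta>(1)]) auto
    have bias: "\<bar>t * h (?\<alpha> \<delta>) t - 1\<bar> * \<bar>psi_bar \<Psi> t\<bar> \<le> c2 * R \<delta>" if "t \<in> ?S" for t
      unfolding c2_def R_def
      using that assms(22)[OF \<alpha> that] assms(25)[OF \<alpha> that] \<open>Cquali > 0\<close>
      by (intro bias_kernel_le[OF \<delta>(1)]) auto
    obtain u where u: "(adjoint A (gd \<delta>), u) \<in> spectral_integral E ?S (h (?\<alpha> \<delta>))"
      "norm (f - u) \<le> c2 * R \<delta> * norm w + c1 * sqrt (\<Psi> (1 / \<delta>\<^sup>2)) * norm (A f - gd \<delta>)"
      by (rule regularisation_error[OF wf meas noise _ bias]) (use c R in auto)
    note u(2)
    also have "c1 * sqrt (\<Psi> (1 / \<delta>\<^sup>2)) * norm (A f - gd \<delta>) \<le> c1 * sqrt (\<Psi> (1 / \<delta>\<^sup>2)) * \<delta>"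
      using assms(19)[OF \<delta>] c R \<open>A f = g\<close> by (intro mult_left_mono) auto
    \<comment> \<open>The noise level \<open>\<delta>\<close> times the kernel bound is
      \<open>c1 * R \<delta>\<close>, the same order as the bias.\<close>
    finally show ?case
      unfolding regularised_solution_def apply_operator_function_eqI[OF gr u(1)]
      by (simp add: R_def algebra_simps)
  qed
  have "(\<lambda>\<delta>. norm (f - regularised_solution A h (gd \<delta>) (?\<alpha> \<delta>)))
      \<in> O[at_right 0](\<lambda>\<delta>. \<delta> * sqrt (\<Psi> (1 / \<delta>\<^sup>2)))"
  proof (rule bigoI[where c = "c2 * norm w + c1"])
    show "\<forall>\<^sub>F \<delta> in at_right 0. norm (norm (f - regularised_solution A h (gd \<delta>) (?\<alpha> \<delta>)))
        \<le> (c2 * norm w + c1) * norm (\<delta> * sqrt (\<Psi> (1 / \<delta>\<^sup>2)))"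
      using bound eventually_at_right_less
    proof eventually_elim
      case (elim \<delta>)
      then show ?case using \<Psi>_pos[of "1 / \<delta>\<^sup>2"] by (simp add: R_def)
    qed
  qed
  \<comment> \<open>The witness is \<open>K = 1\<close>.\<close>
  then show ?thesis using filterlim_Theta_inv zero_less_one by blast
qed

end
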